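(* Let $\ell\ge 1$ be an integer and let $\mathcal{X}\subseteq\mathbb{X}_-^\ell$. Suppose that for some integer $m\ge 1$ there is some $L\in\mathcal{M}_-^{\ell\to m}$ with $L\,\mathbb{X}_-^\ell=\mathbb{X}_-^m$ such that $L\mathcal{X}\subseteq\mathbb{R}^m$ supports a spherical $2$-design. Then, for every integer $n\ge 1$ and every $M\in\mathcal{M}_-^{\ell\to n}$ with $\dim\operatorname{supp}M=m$ and $M^+M=L^+L$, the set $\mathcal{X}$ is observationally complete for $M$ with respect to $\mathbb{X}_-^\ell$.
   Context: Notation. $\mathbb{R}^{\ell\to n}$ is the set of linear maps $\mathbb{R}^\ell\to\mathbb{R}^n$ (real $n\times\ell$ matrices). $M^+$ is the Moore-Penrose pseudoinverse, and $\operatorname{supp}M=(\ker M)^\perp$, so $M^+M$ is the orthogonal projector onto $\operatorname{supp}M$. For a set $S$, $MS=\{Mx: x\in S\}$. $|\cdot|_2$ is the Euclidean norm. For every $k\ge 1$ a nonzero vector $\mathbf{u}_k\in\mathbb{R}^k$ is fixed once and for all, and $\hat{\mathbf{u}}_k=\mathbf{u}_k/|\mathbf{u}_k|_2$. Class of maps. $\mathcal{M}_-^{\ell\to n}=\{M\in\mathbb{R}^{\ell\to n}: M^T\mathbf{u}_n=\mathbf{u}_\ell\}$. State space. For $\mathbf{v}\in\mathbb{R}^\ell$ let $g(\mathbf{v})=|\mathbf{v}|_2-\sqrt2\,\hat{\mathbf{u}}_\ell\cdot\mathbf{v}$. Then $\mathbb{X}_-^\ell=\{\mathbf{v}\in\mathbb{R}^\ell: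 g(\mathbf{v})\le 0,\ \mathbf{u}_\ell\cdot\mathbf{v}=1\}$ (spherical state space). Data-driven inference. For $S\subseteq\mathbb{R}^n$, $\operatorname{vol}(S)$ is the Euclidean volume of $S$ within its affine hull $\operatorname{aff}S$ (a single point has $0$-dimensional volume $1$). For $\mathbb{X}\subseteq\mathbb{R}^\ell$ and $\mathcal{Y}\subseteq\mathbb{R}^n$ let $\mathcal{L}_-(\mathcal{Y}|\mathbb{X})=\{K\in\mathcal{M}_-^{\ell\to n}: \mathcal{Y}\subseteq K\mathbb{X}\subseteq\operatorname{span}\mathcal{Y}\}$. Then $\mathtt{ddi}_-(\mathcal{Y}|\mathbb{X})$ is the set of all images $K\mathbb{X}$, where $K$ ranges over the minimizers of $\operatorname{vol}(K\mathbb{X})$ over $K\in\mathcal{L}_-(\mathcal{Y}|\mathbb{X})$. Observational completeness. A set $\mathcal{X}\subseteq\mathbb{X}\subseteq\mathbb{R}^\ell$ is observationally complete for $M\in\mathcal{M}_-^{\ell\to n}$ with respect to $\mathbb{X}$ if $\mathtt{ddi}_-(M\mathcal{X}|\mathbb{X})=\{M\mathbb{X}\}$. Spherical designs. Let $\{p_k\}$ be a (finite) probability distribution over vectors $\mathbf{v}_k\in\mathbb{R}^m$ with $\mathbf{v}_k\cdot\mathbf{u}_m=1$ for all $k$. Then $\{p_k,\mathbf{v}_k\}$ is a spherical $t$-design if $\sum_k p_k\mathbf{v}_k^{\otimes t}=\int dO\,(O\mathbf{v})^{\otimes t}$ for any $\mathbf{v}$ on the boundary sphere $\{\mathbf{v}\in\mathbb{R}^m:\mathbf{u}_m\cdot\mathbf{v}=1,\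 g(\mathbf{v})=0\}$ of $\mathbb{X}_-^m$, where $dO$ is the normalized Haar measure on the symmetry group of $\mathbb{X}_-^m$, i.e. the group of orthogonal $m\times m$ matrices $O$ with $O\mathbf{u}_m=\mathbf{u}_m$. A set $S\subseteq\mathbb{R}^m$ supports a spherical $t$-design if there are finitely many $\mathbf{v}_k\in S$ with $\mathbf{u}_m\cdot\mathbf{v}_k\neq0$ and a probability distribution $\{p_k\}$ such that $\{p_k,\tilde{\mathbf{v}}_k\}$ is a spherical $t$-design, where $\tilde{\mathbf{v}}_k=(\mathbf{u}_m\cdot\mathbf{v}_k)^{-1}\mathbf{v}_k$. *)

theory Defs
  imports "HOL-Probability.Probability"
begin

(* A linear map from R^l to R^n is a matrix of type real^'l^'n, acting by *v.  The
   distinguished vector of each space is passed as an explicit argument (u, ul, un). *)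

definition pinv :: "real^'l^'n \<Rightarrow> real^'n^'l" where
  "pinv M = (THE P. M ** P ** M = M \<and> P ** M ** P = P \<and>
                    transpose (M ** P) = M ** P \<and> transpose (P ** M) = P ** M)"

definition supp :: "real^'l^'n \<Rightarrow> (real^'l) set" where
  "supp M = {x. M *v x = 0}\<^sup>\<bottom>"

definition maps_minus :: "real^'l \<Rightarrow> real^'n \<Rightarrow> (real^'l^'n) set" where
  "maps_minus ul un = {M. transpose M *v un = ul}"

definition cone_fun :: "real^'l \<Rightarrow> real^'l \<Rightarrow> real" where
  "cone_fun u v = norm v - sqrt 2 * ((u /\<^sub>R norm u) \<bullet> v)"

definition spherical_space :: "real^'l \<Rightarrow> (real^'l) set" where
  "spherical_space u = {v. cone_fun u v \<le> 0 \<and> u \<bullet> v = 1}"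

definition boundary_sphere :: "real^'l \<Rightarrow> (real^'l) set" where
  "boundary_sphere u = {v. u \<bullet> v = 1 \<and> cone_fun u v = 0}"

(* k-dimensional Lebesgue measure on a k-dimensional affine subspace A: the image of the
   standard measure on R^k under the isometric parametrization of A by a base point and an
   orthonormal basis of the direction space; it does not depend on the choice of frame.  The
   sigma-algebra is that of the ambient space, completed, so that the complement of A is a null
   set.  If A is a single point then B = {} and this is the point mass. *)
definition orthonormal_frame :: "'a::euclidean_space set \<Rightarrow> 'a \<times> 'a set \<Rightarrow> bool" where
  "orthonormal_frame A = (\<lambda>(a, B). pairwise orthogonal B \<and> (\<forall>b\<in>B. norm b = 1) \<and>
                                     (\<lambda>x. a + x) ` span B = A)"

definition affine_lebesgue :: "'a::euclidean_space set \<Rightarrow> 'a measure" where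
  "affine_lebesgue A = (let (a, B) = (SOME F. orthonormal_frame A F) in
     completion (distr (Pi\<^sub>M B (\<lambda>_. lborel :: real measure)) borel
                       (\<lambda>f. a + (\<Sum>b\<in>B. f b *\<^sub>R b))))"

definition vol :: "'a::euclidean_space set \<Rightarrow> ennreal" where
  "vol S = emeasure (affine_lebesgue (affine hull S)) S"

definition ddi_candidates ::
    "real^'l \<Rightarrow> real^'n \<Rightarrow> (real^'n) set \<Rightarrow> (real^'l) set \<Rightarrow> (real^'l^'n) set" where
  "ddi_candidates ul un Y X =
     {K \<in> maps_minus ul un. Y \<subseteq> (*v) K ` X \<and> (*v) K ` X \<subseteq> span Y}"

definition ddi ::
    "real^'l \<Rightarrow> real^'n \<Rightarrow> (real^'n) set \<Rightarrow> (real^'l) set \<Rightarrow> (real^'n) set set" where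
  "ddi ul un Y X =
     {(*v) K ` X |K. is_arg_min (\<lambda>K. vol ((*v) K ` X)) (\<lambda>K. K \<in> ddi_candidates ul un Y X) K}"

definition observationally_complete ::
    "real^'l \<Rightarrow> real^'n \<Rightarrow> (real^'l) set \<Rightarrow> (real^'l) set \<Rightarrow> real^'l^'n \<Rightarrow> bool" where
  "observationally_complete ul un S X M \<longleftrightarrow> ddi ul un ((*v) M ` S) X = {(*v) M ` X}"

definition symmetry_group :: "real^'m \<Rightarrow> (real^'m^'m) set" where
  "symmetry_group u = {Q. orthogonal_matrix Q \<and> Q *v u = u}"

(* Intended for compact matrix groups G, where such a measure exists and is unique. *)
definition normalized_haar :: "(real^'m^'m) set \<Rightarrow> (real^'m^'m) measure" where
  "normalized_haar G = (THE \<mu>. prob_space \<mu> \<and> sets \<mu> = sets (restrict_space borel G) \<and>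
                               (\<forall>g\<in>G. distr \<mu> \<mu> (\<lambda>h. g ** h) = \<mu>))"

(* Component of the t-fold tensor power of v at the multi-index (i 0, ..., i (t - 1)); only
   these t values of i matter. *)
definition tensor_power :: "nat \<Rightarrow> real^'m \<Rightarrow> (nat \<Rightarrow> 'm) \<Rightarrow> real" where
  "tensor_power t v i = (\<Prod>j<t. v $ i j)"

definition spherical_design ::
    "real^'m \<Rightarrow> nat \<Rightarrow> nat \<Rightarrow> (nat \<Rightarrow> real) \<Rightarrow> (nat \<Rightarrow> real^'m) \<Rightarrow> bool" where
  "spherical_design u t N p v \<longleftrightarrow>
     (\<forall>k<N. 0 \<le> p k) \<and> (\<Sum>k<N. p k) = 1 \<and> (\<forall>k<N. v k \<bullet> u = 1) \<and>
     (\<forall>w\<in>boundary_sphere u. \<forall>i.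
        (\<Sum>k<N. p k * tensor_power t (v k) i) =
        (\<integral>Q. tensor_power t (Q *v w) i \<partial>normalized_haar (symmetry_group u)))"

definition supports_spherical_design :: "real^'m \<Rightarrow> nat \<Rightarrow> (real^'m) set \<Rightarrow> bool" where
  "supports_spherical_design u t S \<longleftrightarrow>
     (\<exists>N p v. (\<forall>k<N. v k \<in> S \<and> u \<bullet> v k \<noteq> 0) \<and>
              spherical_design u t N p (\<lambda>k. inverse (u \<bullet> v k) *\<^sub>R v k))"

end

theory Submission
  imports Defs
begin

text \<open>Since \<open>M\<close> and \<open>L\<close> have the same support, \<open>M = P L\<close> with \<open>P\<close> injective, so everything takes place
  in the ball \<open>X\<close> of \<open>\<real>\<^sup>m\<close>: an admissible \<open>K\<close> has image \<open>P (H X)\<close> for an invertible \<open>H\<close> such that the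
  ellipsoid \<open>H X\<close> contains the points of the 2-design, and its volume is \<open>\<bar>det H\<bar>\<close> times that of \<open>P X\<close>.
  By invariance under the symmetry group, the second moment of a 2-design is that of the sphere. Averaging
  the inequality \<open>\<bar>H\<^sup>-\<^sup>1 v\<bar>\<^sup>2 \<le> 2 / \<bar>u\<bar>\<^sup>2\<close> over the design therefore bounds the Frobenius norm of \<open>H\<^sup>-\<^sup>1\<close>,
  hence its determinant, and the equality case forces \<open>H\<close> to be a symmetry of \<open>X\<close> (John's argument).\<close>

subsection \<open>Lebesgue measure of linear images\<close>

text \<open>The volume lives in the hyperplane \<open>u \<bullet> x = 1\<close>, while determinants
  belong to R^m; and an admissible map preserves the functional \<open>u \<bullet> x\<close> without
  having to fix \<open>u\<close>, since the ellipsoid may be off centre. A shear along the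
  hyperplane, of determinant 1 in absolute value, repairs both mismatches. For volumes it restores
  the direction of a prism erected over the hyperplane. In the averaged inequality it absorbs the
  term in which a displaced centre would help; the positive term that remains forces the centre to
  stay put in the equality case. The constants: a boundary point is the centre u/|u|^2 plus an
  orthogonal vector of length 1/|u|. For m > 1 the orthogonal part of the second moment is thus
  \<beta> times the identity with \<beta> (m - 1) = 1/|u|^2, and the averaged inequality gives a
  squared Frobenius norm of at most m, the value at the identity. Haar measure and pseudoinverse are
  definite descriptions, so existence and uniqueness must come before any use of a design or of a
  projector.\<close>

lemma translation_invariant_measure:
  fixes \<nu> :: "'a::euclidean_space measure"
  assumes sets: "sets \<nu> = sets borel" and sf: "sigma_finite_measure \<nu>"
    and inv: "\<And>c. distr \<nu> borel (\<lambda>x. c + x) = \<nu>" and A: "A \<in> sets borel"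
  shows "emeasure \<nu> A = emeasure \<nu> (cbox 0 One) * emeasure lborel A"
proof -
  interpret nu: sigma_finite_measure \<nu> by fact
  interpret pair_sigma_finite \<nu> "lborel :: 'a measure"
    by (simp add: pair_sigma_finite_def sf sigma_finite_lborel)
  note [measurable_cong] = sets
  note [measurable] = A
  let ?U = "cbox 0 One :: 'a set"
  have [simp]: "emeasure lborel ?U = 1"
    by (simp add: emeasure_lborel_cbox_eq)
  have shift: "(\<integral>\<^sup>+ y. f (x + y) \<partial>lborel) = (\<integral>\<^sup>+ y. f y \<partial>lborel)"
    if [measurable]: "f \<in> borel_measurable borel" for f and x :: 'a
    by (subst lborel_distr_plus[of x, symmetric], subst nn_integral_distr) auto
  have refl: "(\<integral>\<^sup>+ y. f (x - y) \<partial>lborel) = (\<integral>\<^sup>+ y. f y \<partial>lborel)"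
    if [measurable]: "f \<in> borel_measurable borel" for f and x :: 'a
    by (subst lborel_affine[of "-1" x]) (simp_all add: nn_integral_density nn_integral_distr density_1)
  have nushift: "(\<integral>\<^sup>+ x. f (y + x) \<partial>\<nu>) = (\<integral>\<^sup>+ x. f x \<partial>\<nu>)"
    if [measurable]: "f \<in> borel_measurable borel" for f and y :: 'a
    by (subst inv[of y, symmetric], subst nn_integral_distr) auto
  \<comment> \<open>The inserted factor is the Lebesgue measure 1 of a translated unit cube. Fubini
    and the invariance of both measures then exchange the roles of \<open>A\<close> and the
    cube.\<close>
  have "emeasure \<nu> A = (\<integral>\<^sup>+ x. indicator A x * (\<integral>\<^sup>+ y. indicator ?U (x + y) \<partial>lborel) \<partial>\<nu>)"
    using A by (subst shift) (auto simp: sets)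
  also have "\<dots> = (\<integral>\<^sup>+ x. \<integral>\<^sup>+ y. indicator A x * indicator ?U (x + y) \<partial>lborel \<partial>\<nu>)"
    by (simp add: nn_integral_cmult)
  also have "\<dots> = (\<integral>\<^sup>+ y. \<integral>\<^sup>+ x. indicator A x * indicator ?U (x + y) \<partial>\<nu> \<partial>lborel)"
    by (rule Fubini'[symmetric]) measurable
  also have "\<dots> = (\<integral>\<^sup>+ y. \<integral>\<^sup>+ x. indicator A (x - y) * indicator ?U x \<partial>\<nu> \<partial>lborel)"
  proof (rule nn_integral_cong)
    fix y :: 'a
    show "(\<integral>\<^sup>+ x. indicator A x * indicator ?U (x + y) \<partial>\<nu>) = (\<integral>\<^sup>+ x. indicator A (x - y) * indicator ?U x \<partial>\<nu>)"
      using nushift[of "\<lambda>x. indicator A (x - y) * indicator ?U x" y] by (simp add: add.commute)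
  qed
  also have "\<dots> = (\<integral>\<^sup>+ x. \<integral>\<^sup>+ y. indicator A (x - y) * indicator ?U x \<partial>lborel \<partial>\<nu>)"
    by (rule Fubini') measurable
  also have "\<dots> = (\<integral>\<^sup>+ x. emeasure lborel A * indicator ?U x \<partial>\<nu>)"
    by (simp add: nn_integral_multc refl[of "indicator A"])
  also have "\<dots> = emeasure \<nu> ?U * emeasure lborel A"
    by (simp add: nn_integral_cmult sets mult.commute)
  finally show ?thesis .
qed

lemma emeasure_lborel_linear_image_eq:
  fixes f g :: "'a::euclidean_space \<Rightarrow> 'a"
  assumes f: "linear f" and g: "linear g" and gf: "\<And>x. g (f x) = x" and fg: "\<And>x. f (g x) = x"
    and S: "S \<in> sets borel"
  shows "emeasure lborel (f ` S) = emeasure lborel (f ` cbox 0 One) * emeasure lborel S"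
proof -
  have im: "f ` S = g -` S" for S
    by (auto simp: image_iff gf) (metis fg)
  have [measurable]: "f \<in> borel_measurable borel" "g \<in> borel_measurable borel"
    using f g by (auto intro!: borel_measurable_continuous_onI linear_continuous_on linear_conv_bounded_linear[THEN iffD1])
  let ?\<nu> = "distr lborel borel g"
  have eq: "emeasure ?\<nu> S = emeasure lborel (f ` S)" if "S \<in> sets borel" for S
    using that by (simp add: emeasure_distr im)
  have "sigma_finite_measure ?\<nu>"
  proof
    let ?A = "range (\<lambda>n::nat. cball (0::'a) n)"
    have "compact (f ` cball 0 n)" for n :: real
      using f by (auto intro!: compact_continuous_image linear_continuous_on simp: linear_conv_bounded_linear)
    then have "emeasure ?\<nu> (cball 0 n) \<noteq> \<infinity>" for n
      using emeasure_compact_finite[of "f ` cball 0 n"] by (subst eq) auto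
    then show "\<exists>A. countable A \<and> A \<subseteq> sets ?\<nu> \<and> \<Union> A = space ?\<nu> \<and> (\<forall>a\<in>A. emeasure ?\<nu> a \<noteq> \<infinity>)"
      by (intro exI[of _ ?A]) (auto simp: real_arch_simple less_top)
  qed
  moreover have "distr ?\<nu> borel (\<lambda>x. c + x) = ?\<nu>" for c
  proof -
    have "distr ?\<nu> borel (\<lambda>x. c + x) = distr (distr lborel borel (\<lambda>x. f c + x)) borel g"
      by (simp add: distr_distr o_def linear_add[OF g] gf)
    then show ?thesis
      by (simp add: lborel_distr_plus)
  qed
  ultimately show ?thesis
    using translation_invariant_measure[of ?\<nu> S] S by (simp add: eq)
qed

text \<open>The unit ball is mapped onto itself and has finite positive measure, so the scaling
  constant can only be 1.\<close>

lemma emeasure_lborel_orthogonal_image: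
  fixes f :: "'a::euclidean_space \<Rightarrow> 'a"
  assumes f: "orthogonal_transformation f" and S: "S \<in> sets borel"
  shows "emeasure lborel (f ` S) = emeasure lborel S"
proof -
  have lin: "linear f" "linear (inv f)" and gf: "\<And>x. inv f (f x) = x" and fg: "\<And>x. f (inv f x) = x"
    using f orthogonal_transformation_bij[OF f]
    by (auto simp: orthogonal_transformation_linear orthogonal_transformation_inv bij_is_inj bij_is_surj surj_f_inv_f)
  let ?k = "emeasure lborel (f ` cbox 0 One)"
  have "emeasure lborel (f ` cball 0 1) = ?k * emeasure lborel (cball (0::'a) 1)"
    by (rule emeasure_lborel_linear_image_eq[OF lin gf fg]) auto
  moreover have "f ` cball 0 1 = cball 0 1"
    using image_orthogonal_transformation_cball[OF f, of 0 1] lin by (simp add: linear_0)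
  moreover have "emeasure lborel (cball (0::'a) 1) \<noteq> \<infinity>"
    using emeasure_lborel_cball_finite[of 0 1] by (simp add: less_top)
  moreover have "emeasure lborel (cball (0::'a) 1) \<noteq> 0"
  proof -
    have "emeasure lborel (ball (0::'a) 1) > 0"
      using open_not_negligible[of "ball (0::'a) 1"]
      by (auto simp: negligible_iff_emeasure0 zero_less_iff_neq_zero)
    then show ?thesis
      using emeasure_mono[of "ball (0::'a) 1" "cball 0 1" lborel] by (auto simp: ball_subset_cball)
  qed
  ultimately have "emeasure lborel (cball (0::'a) 1) * ?k = emeasure lborel (cball (0::'a) 1) * 1"
      "emeasure lborel (cball (0::'a) 1) \<noteq> \<infinity>" "emeasure lborel (cball (0::'a) 1) \<noteq> 0"
    by (simp_all add: mult.commute)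
  then have "?k = 1"
    unfolding ennreal_mult_cancel_left by auto
  then show ?thesis
    using emeasure_lborel_linear_image_eq[of f "inv f", OF lin gf fg S] by (simp only: mult_1)
qed

text \<open>The library's \<open>measure_linear_image\<close> needs a well-ordered index type.\<close>

lemma emeasure_lborel_matrix_image:
  fixes A :: "real^'n^'n"
  assumes det: "det A \<noteq> 0" and S: "S \<in> sets borel"
  shows "emeasure lborel ((*v) A ` S) = ennreal \<bar>det A\<bar> * emeasure lborel S"
proof -
  define k where "k A = emeasure lborel ((*v) A ` cbox 0 One)" for A :: "real^'n^'n"
  have scale: "emeasure lborel ((*v) A ` S) = k A * emeasure lborel S"
    if dA: "det A \<noteq> 0" "S \<in> sets borel" for A and S :: "(real^'n) set"
  proof -
    obtain B where B: "A ** B = mat 1" "B ** A = mat 1"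
      using dA invertible_det_nz[of A] unfolding invertible_def by blast
    show ?thesis
      unfolding k_def
      by (rule emeasure_lborel_linear_image_eq[of _ "(*v) B"])
        (auto simp: matrix_vector_mul_assoc B that)
  qed
  have cU: "emeasure lborel (cbox 0 One :: (real^'n) set) = 1"
    by (simp add: emeasure_lborel_cbox_eq)
  have kmul: "k (A ** B) = k A * k B" if "det A \<noteq> 0" "det B \<noteq> 0" for A B
  proof -
    have "compact ((*v) B ` cbox 0 One)"
      by (intro compact_continuous_image linear_continuous_on) auto
    then show ?thesis
      using scale[OF that(1), of "(*v) B ` cbox 0 One"]
      by (simp add: k_def matrix_vector_mult_matrix_matrix_mult_compose image_comp compact_imp_closed)
  qed
  have kfin: "k A < \<infinity>" for A
    unfolding k_def by (intro emeasure_compact_finite compact_continuous_image linear_continuous_on) auto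
  have kpos: "k A \<noteq> 0" if dA: "det A \<noteq> 0" for A
  proof -
    obtain B where B: "A ** B = mat 1" "B ** A = mat 1"
      using dA invertible_det_nz[of A] unfolding invertible_def by blast
    then have "det A * det B = 1"
      by (metis det_I det_mul)
    then have "det B \<noteq> 0" by auto
    have "k A * k B = 1"
      using kmul[OF that \<open>det B \<noteq> 0\<close>] B cU by (simp add: k_def)
    then show ?thesis by auto
  qed
  have korth: "k A = 1" if "orthogonal_matrix A" for A
    using that by (simp add: k_def emeasure_lborel_orthogonal_image orthogonal_transformation_matrix cU)
  \<comment> \<open>Both sides are multiplicative on invertible matrices, so elementary factors
    suffice. The premise passes to both factors of a product and makes the zero-row case
    vacuous.\<close>
  have "det A \<noteq> 0 \<longrightarrow> k A = ennreal \<bar>det A\<bar>"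
  proof (induction rule: induct_matrix_elementary)
    case (1 A B)
    then show ?case by (auto simp: kmul det_mul abs_mult ennreal_mult)
  next
    case (2 A i)
    then show ?case
      using det_zero_row[of i A] by (auto simp: row_def vec_eq_iff)
  next
    case (3 A)
    show ?case
    proof
      assume d0: "det A \<noteq> 0"
      have dA: "det A = (\<Prod>i\<in>UNIV. A$i$i)"
        using 3 by (rule det_diagonal)
      with d0 have nz: "A$i$i \<noteq> 0" for i by auto
      \<comment> \<open>The affine change of variables takes one factor per basis vector; this sum
        reads the diagonal entry off \<open>axis i 1\<close>.\<close>
      let ?c = "\<lambda>j::real^'n. \<Sum>i\<in>UNIV. A$i$i * j$i"
      have c_axis: "?c (axis i 1) = A$i$i" for i
        by (simp add: axis_def if_distrib cong: if_cong)
      have inB: "axis i 1 \<in> (Basis :: (real^'n) set)" for i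
        by simp
      have diag: "(A *v x) $ i = A$i$i * x$i" for x i
        using 3 by (simp add: matrix_vector_mult_def sum.remove[of UNIV i])
      have Av: "0 + (\<Sum>j\<in>Basis. (?c j * (x \<bullet> j)) *\<^sub>R j) = A *v x" for x :: "real^'n"
      proof -
        have "(\<Sum>j\<in>Basis. (?c j * (x \<bullet> j)) *\<^sub>R j) $ i = (A *v x) $ i" for i
          unfolding cart_eq_inner_axis[of "sum _ _"] inner_sum_left_Basis[OF inB]
          by (simp only: c_axis diag inner_axis) simp
        then show ?thesis
          by (simp add: vec_eq_iff del: sum_component)
      qed
      have cnz: "?c j \<noteq> 0" if "j \<in> Basis" for j
        using that nz by (auto simp: Basis_vec_def c_axis)
      have "(lborel :: (real^'n) measure) = density (distr lborel borel ((*v) A)) (\<lambda>_. ennreal (\<Prod>j\<in>Basis. \<bar>?c j\<bar>))"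
        using lborel_affine_euclidean[of ?c 0, OF cnz] unfolding Av .
      note lb = this
      have prodB: "(\<Prod>j\<in>Basis. \<bar>?c j\<bar>) = \<bar>det A\<bar>"
      proof -
        have "(\<Prod>j\<in>Basis. \<bar>?c j\<bar>) = (\<Prod>i\<in>UNIV. \<bar>A$i$i\<bar>)"
          by (rule prod.reindex_cong[of "\<lambda>i. axis i 1"])
            (auto simp: Basis_vec_def inj_def axis_eq_axis c_axis)
        then show ?thesis
          by (simp only: dA abs_prod)
      qed
      have "inj ((*v) A)"
        using d0 by (simp add: inj_matrix_vector_mult invertible_det_nz)
      have "compact ((*v) A ` cbox 0 One)"
        by (intro compact_continuous_image linear_continuous_on) auto
      then have [measurable]: "(*v) A ` cbox 0 One \<in> sets borel"
        by (simp add: compact_imp_closed)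
      have [measurable]: "(*v) A \<in> borel_measurable borel"
        by (intro borel_measurable_continuous_onI linear_continuous_on) auto
      have "k A = ennreal \<bar>det A\<bar> * emeasure lborel ((*v) A -` ((*v) A ` cbox 0 One))"
        unfolding k_def
        by (subst lb) (simp add: emeasure_density prodB nn_integral_cmult emeasure_distr)
      then show "k A = ennreal \<bar>det A\<bar>"
        using \<open>inj ((*v) A)\<close> by (simp add: inj_vimage_image_eq cU)
    qed
  next
    case (4 m n)
    let ?t = "Transposition.transpose m n"
    define P where "P = ((\<chi> i j. mat 1 $ i $ ?t j) :: real^'n^'n)"
    have ent: "P $ k $ i = (if k = ?t i then 1 else 0)" for k i
      by (simp add: P_def mat_def)
    have "(transpose P ** P) $ i $ j = mat 1 $ i $ j" for i j
    proof -
      have "(transpose P ** P) $ i $ j = (\<Sum>k\<in>UNIV. P $ k $ i * P $ k $ j)"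
        by (simp add: matrix_matrix_mult_def transpose_def)
      also have "\<dots> = (\<Sum>k\<in>UNIV. (if k = ?t i then (if k = ?t j then 1 else 0) else 0))"
        by (rule sum.cong) (auto simp: ent)
      also have "\<dots> = (if ?t i = ?t j then 1 else 0)"
        by (subst sum.delta) auto
      also have "\<dots> = mat 1 $ i $ j"
        unfolding mat_def by (auto dest: injD[OF inj_transpose])
      finally show ?thesis .
    qed
    then have "orthogonal_matrix P"
      by (simp add: orthogonal_matrix vec_eq_iff)
    then show ?case
      unfolding P_def[symmetric]
      using korth det_orthogonal_matrix by fastforce
  next
    case (5 m n c)
    define E where "E c = (\<chi> i j. if i = m \<and> j = n then c else of_bool (i = j) :: real^'n^'n)" for c
    \<comment> \<open>Conjugating \<open>E c\<close> by \<open>D\<close> doubles \<open>c\<close>,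
      and so does squaring \<open>E c\<close>. Hence k (E c) = k (E c)^2, and a finite nonzero
      \<open>k (E c)\<close> must be 1.\<close>
    define D where "D = (\<chi> i j. if i = j then (if i = m then 2 else 1) else 0 :: real^'n^'n)"
    have detE: "det (E c) = 1" for c
    proof -
      have "E c = (\<chi> k. if k = m then row m (mat 1) + c *s row n (mat 1) else row k (mat 1))"
        using 5 by (auto simp: E_def row_def mat_def vec_eq_iff)
      then show ?thesis
        using det_row_operation[OF 5, of "mat 1" c] by simp
    qed
    have "det D = (\<Prod>i\<in>UNIV. if i = m then 2 else 1)"
      unfolding D_def by (subst det_diagonal) auto
    then have detD: "det D \<noteq> 0" by simp
    have EE: "E c ** E c = E (2 * c)"
      using 5 by (auto simp: E_def matrix_matrix_mult_def vec_eq_iff of_bool_def if_distrib[of "\<lambda>x. x * y" for y] 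
          sum.remove[of UNIV m] sum.remove[of "UNIV - {m}" n] cong: if_cong)
    have DE: "D ** E c = E (2 * c) ** D"
      using 5 by (auto simp: E_def D_def matrix_matrix_mult_def vec_eq_iff of_bool_def if_distrib[of "\<lambda>x. x * y" for y] 
          if_distrib[of "\<lambda>x. y * x" for y] sum.remove[of UNIV m] sum.remove[of "UNIV - {m}" n] cong: if_cong)
    have "k D * k (E c) = k D * (k (E c) * k (E c))"
      using kmul[of D "E c"] kmul[of "E (2 * c)" D] kmul[of "E c" "E c"] detE detD DE EE
      by (simp add: mult.commute mult.left_commute)
    then have "k (E c) * 1 = k (E c) * k (E c)"
      using kpos[of D] kfin[of D] detD by (auto simp: ennreal_mult_cancel_left less_top)
    then have "k (E c) = 1"
      using kpos[of "E c"] kfin[of "E c"] detE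
      unfolding ennreal_mult_cancel_left by (auto simp: less_top)
    then show ?case
      using detE[of c] unfolding E_def by simp
  qed
  then show ?thesis
    using scale[OF det S] det by simp
qed

subsection \<open>Haar measure on the symmetry group\<close>

lemma symmetry_group_mult:
  "\<lbrakk>g \<in> symmetry_group u; h \<in> symmetry_group u\<rbrakk> \<Longrightarrow> g ** h \<in> symmetry_group u"
  unfolding symmetry_group_def
  by (auto simp: orthogonal_matrix_mul simp flip: matrix_vector_mul_assoc)

lemma symmetry_group_transpose:
  assumes "g \<in> symmetry_group u" shows "transpose g \<in> symmetry_group u"
proof -
  have "transpose g ** g = mat 1" "g *v u = u"
    using assms by (auto simp: symmetry_group_def orthogonal_matrix)
  then have "transpose g *v u = u"
    by (metis matrix_vector_mul_assoc matrix_vector_mul_lid)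
  then show ?thesis
    using assms by (simp add: symmetry_group_def orthogonal_matrix_transpose)
qed

lemma symmetry_group_inverse:
  "g \<in> symmetry_group u \<Longrightarrow> transpose g ** g = mat 1"
  "g \<in> symmetry_group u \<Longrightarrow> g ** transpose g = mat 1"
  by (auto simp: symmetry_group_def orthogonal_matrix_def)

lemma symmetry_group_one: "mat 1 \<in> symmetry_group u"
  by (simp add: symmetry_group_def orthogonal_matrix_id)

lemma continuous_on_matrix_mult [continuous_intros]:
  fixes f :: "'a::topological_space \<Rightarrow> real^'m^'n" and g :: "'a \<Rightarrow> real^'k^'m"
  shows "\<lbrakk>continuous_on S f; continuous_on S g\<rbrakk> \<Longrightarrow> continuous_on S (\<lambda>x. f x ** g x)"
  unfolding matrix_matrix_mult_def
  by (intro continuous_on_vec_lambda continuous_on_sum continuous_on_mult continuous_on_component)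

lemma continuous_on_matrix_vector [continuous_intros]:
  fixes f :: "'a::topological_space \<Rightarrow> real^'m^'n" and g :: "'a \<Rightarrow> real^'m"
  shows "\<lbrakk>continuous_on S f; continuous_on S g\<rbrakk> \<Longrightarrow> continuous_on S (\<lambda>x. f x *v g x)"
  unfolding matrix_vector_mult_def
  by (intro continuous_on_vec_lambda continuous_on_sum continuous_on_mult continuous_on_component)

lemma continuous_on_transpose [continuous_intros]:
  fixes f :: "'a::topological_space \<Rightarrow> real^'m^'n"
  shows "continuous_on S f \<Longrightarrow> continuous_on S (\<lambda>x. transpose (f x))"
  unfolding transpose_def
  by (intro continuous_on_vec_lambda continuous_on_component)

lemma closed_symmetry_group: "closed (symmetry_group u)"
proof -
  have eq: "symmetry_group u = {g. transpose g ** g = mat 1} \<inter> {g. g *v u = u}"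
    by (auto simp: symmetry_group_def orthogonal_matrix)
  show ?thesis
    unfolding eq by (intro closed_Int closed_Collect_eq continuous_intros)
qed

text \<open>Gram--Schmidt; after a linearly dependent entry it returns the junk value \<open>0\<close>.\<close>

function gram_schmidt :: "(nat \<Rightarrow> 'a::real_inner) \<Rightarrow> nat \<Rightarrow> 'a" where
  "gram_schmidt a n = (let r = a n - (\<Sum>j<n. (a n \<bullet> gram_schmidt a j) *\<^sub>R gram_schmidt a j) in r /\<^sub>R norm r)"
  by auto
termination by (relation "Wellfounded.measure snd") auto

declare gram_schmidt.simps [simp del]

lemma gram_schmidt_orthonormal:
  assumes "\<And>k. k < n \<Longrightarrow> gram_schmidt a k \<noteq> 0" "i < n" "j < n"
  shows "gram_schmidt a i \<bullet> gram_schmidt a j = (if i = j then 1 else 0)"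
  using assms
proof (induction n arbitrary: i j)
  case 0
  then show ?case by simp
next
  case (Suc n)
  have IH: "gram_schmidt a i \<bullet> gram_schmidt a j = (if i = j then 1 else 0)" if "i < n" "j < n" for i j
    using Suc that by simp
  define r where "r = a n - (\<Sum>j<n. (a n \<bullet> gram_schmidt a j) *\<^sub>R gram_schmidt a j)"
  have gram_schmidt: "gram_schmidt a n = r /\<^sub>R norm r"
    by (subst gram_schmidt.simps) (simp add: r_def Let_def)
  have "r \<noteq> 0"
    using Suc.prems(1)[of n] by (auto simp: gram_schmidt)
  then have self: "gram_schmidt a n \<bullet> gram_schmidt a n = 1"
    by (simp add: gram_schmidt flip: power2_norm_eq_inner)
  have orth: "gram_schmidt a n \<bullet> gram_schmidt a j = 0" if "j < n" for j
  proof -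
    have "(\<Sum>i<n. (a n \<bullet> gram_schmidt a i) *\<^sub>R gram_schmidt a i) \<bullet> gram_schmidt a j = a n \<bullet> gram_schmidt a j"
      using that by (simp add: inner_sum_left IH if_distrib[of "\<lambda>x. _ * x"] cong: if_cong)
    then show ?thesis
      by (simp add: gram_schmidt r_def inner_diff_left)
  qed
  show ?case
    using Suc.prems self orth IH by (auto simp: less_Suc_eq inner_commute)
qed

text \<open>Serves to exhibit one matrix at which the process does not degenerate.\<close>

lemma gram_schmidt_of_orthonormal:
  assumes "\<And>i j. \<lbrakk>i < n; j < n\<rbrakk> \<Longrightarrow> f i \<bullet> f j = (if i = j then 1 else (0::real))"
    and "\<And>k. k < n \<Longrightarrow> a k = c k *\<^sub>R f k" "\<And>k. k < n \<Longrightarrow> c k > 0" "k < n"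
  shows "gram_schmidt a k = f k"
  using assms(4)
proof (induction k rule: less_induct)
  case (less k)
  have "(\<Sum>j<k. (a k \<bullet> gram_schmidt a j) *\<^sub>R gram_schmidt a j) = 0"
    using less assms by (intro sum.neutral) auto
  moreover have "norm (f k) = 1"
    using assms(1)[of k k] less.prems by (simp add: norm_eq_sqrt_inner)
  ultimately show ?case
    using assms(2,3)[of k] less.prems by (subst gram_schmidt.simps) (simp add: Let_def)
qed

text \<open>All coefficients are inner products and norms, which \<open>g\<close> preserves.
  Degenerate entries are included, since both sides are then 0.\<close>

lemma gram_schmidt_orthogonal_transformation:
  assumes "orthogonal_transformation g"
  shows "gram_schmidt (\<lambda>k. g (a k)) n = g (gram_schmidt a n)"
proof (induction n rule: less_induct)
  case (less n)
  have lin: "linear g" and ip: "\<And>x y. g x \<bullet> g y = x \<bullet> y" and nrm: "\<And>x. norm (g x) = norm x"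
    using assms by (auto simp: orthogonal_transformation_def norm_eq_sqrt_inner)
  define r where "r = a n - (\<Sum>j<n. (a n \<bullet> gram_schmidt a j) *\<^sub>R gram_schmidt a j)"
  have "g (a n) - (\<Sum>j<n. (g (a n) \<bullet> gram_schmidt (\<lambda>k. g (a k)) j) *\<^sub>R gram_schmidt (\<lambda>k. g (a k)) j) = g r"
    unfolding r_def using less
    by (simp add: linear_diff[OF lin] linear_sum[OF lin] linear_scale[OF lin] ip)
  then show ?case
    using gram_schmidt.simps[of "\<lambda>k. g (a k)" n] gram_schmidt.simps[of a n]
    by (simp add: Let_def r_def[symmetric] linear_scale[OF lin] nrm)
qed

lemma borel_measurable_gram_schmidt:
  fixes a :: "'b \<Rightarrow> nat \<Rightarrow> 'a::euclidean_space"
  assumes [measurable]: "\<And>k. (\<lambda>x. a x k) \<in> borel_measurable M"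
  shows "(\<lambda>x. gram_schmidt (a x) n) \<in> borel_measurable M"
proof (induction n rule: less_induct)
  case (less n)
  have [measurable]: "(\<lambda>x. \<Sum>j<n. (a x n \<bullet> gram_schmidt (a x) j) *\<^sub>R gram_schmidt (a x) j) \<in> borel_measurable M"
    using less by (intro borel_measurable_sum borel_measurable_scaleR borel_measurable_inner) auto
  show ?case
    by (subst gram_schmidt.simps) (unfold Let_def, measurable)
qed

text \<open>Normalisation is continuous only where the residual is nonzero, so every entry up to
  \<open>n\<close> must be nondegenerate at the point in question.\<close>

lemma isCont_gram_schmidt:
  fixes a :: "'b::t2_space \<Rightarrow> nat \<Rightarrow> 'a::real_inner"
  assumes cont: "\<And>k. isCont (\<lambda>x. a x k) x" and nz: "\<And>k. k \<le> n \<Longrightarrow> gram_schmidt (a x) k \<noteq> 0"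
  shows "isCont (\<lambda>x. gram_schmidt (a x) n) x"
  using nz
proof (induction n rule: less_induct)
  case (less n)
  define r where "r y = a y n - (\<Sum>j<n. (a y n \<bullet> gram_schmidt (a y) j) *\<^sub>R gram_schmidt (a y) j)" for y
  have gram_schmidt: "gram_schmidt (a y) n = r y /\<^sub>R norm (r y)" for y
    by (subst gram_schmidt.simps) (simp add: r_def Let_def)
  have IH: "isCont (\<lambda>x. gram_schmidt (a x) j) x" if "j < n" for j
    using less that by auto
  have "isCont r x"
    unfolding r_def using IH cont by (intro continuous_intros) auto
  moreover have "r x \<noteq> 0"
    using less.prems[of n] by (auto simp: gram_schmidt)
  ultimately show ?case
    unfolding gram_schmidt by (intro continuous_intros) auto
qed

lemma borel_measurable_vec_lambda:
  fixes f :: "'a \<Rightarrow> 'i::finite \<Rightarrow> 'b::euclidean_space"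
  assumes "\<And>i. (\<lambda>x. f x i) \<in> borel_measurable M"
  shows "(\<lambda>x. \<chi> i. f x i) \<in> borel_measurable M"
proof (rule borel_measurable_euclidean_space[THEN iffD2], rule ballI)
  fix b :: "'b^'i" assume "b \<in> Basis"
  then obtain i c where b: "b = axis i c" by (auto simp: Basis_vec_def)
  have "(\<lambda>x. f x i \<bullet> c) \<in> borel_measurable M"
    using assms by (intro borel_measurable_inner) auto
  then show "(\<lambda>x. (\<chi> i. f x i) \<bullet> b) \<in> borel_measurable M"
    by (simp add: b inner_axis)
qed

lemma orthogonal_transformation_rows:
  fixes g :: "real^'m^'m"
  assumes "orthogonal_matrix g"
  shows "orthogonal_transformation (\<lambda>A :: real^'m^'n. \<chi> j. g *v (A $ j))"
proof -
  have "(g *v x) \<bullet> (g *v y) = x \<bullet> y" for x y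
    using assms by (metis orthogonal_transformation_def orthogonal_transformation_matrix matrix_vector_mul_linear matrix_of_matrix_vector_mul)
  then show ?thesis
    unfolding orthogonal_transformation_def
    by (auto simp: inner_vec_def[where 'a="real^'m"] vec_eq_iff[where 'a="real^'m"] matrix_vector_right_distrib matrix_vector_mult_scaleR intro!: linearI)
qed

lemma symmetry_group_measurable_mult:
  fixes g :: "real^'m^'m"
  assumes "g \<in> symmetry_group u" "sets M = sets (restrict_space borel (symmetry_group u))"
  shows "(\<lambda>h. g ** h) \<in> measurable M M"
proof -
  have "(\<lambda>h. g ** h) \<in> borel_measurable borel"
    by (intro borel_measurable_continuous_onI continuous_intros)
  then have "(\<lambda>h. g ** h) \<in> measurable (restrict_space borel (symmetry_group u)) (restrict_space borel (symmetry_group u))"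
    using assms(1) by (auto intro!: measurable_restrict_space3 symmetry_group_mult)
  then show ?thesis
    using assms(2) by (simp cong: measurable_cong_sets)
qed

text \<open>The Gram--Schmidt frame of a random matrix, with \<open>u\<close> prescribed as the first vector, is equivariant.\<close>

lemma haar_exists:
  fixes u :: "real^'m"
  assumes u: "u \<noteq> 0"
  defines "G \<equiv> symmetry_group u"
  shows "\<exists>\<mu>. prob_space \<mu> \<and> sets \<mu> = sets (restrict_space borel G) \<and> (\<forall>g\<in>G. distr \<mu> \<mu> (\<lambda>h. g ** h) = \<mu>)"
proof -
  define d where "d = CARD('m)"
  obtain h :: "nat \<Rightarrow> 'm" where h: "bij_betw h {0..<d} UNIV"
    using ex_bij_betw_nat_finite[of "UNIV :: 'm set"] d_def by auto
  define \<kappa> where "\<kappa> = inv_into {0..<d} h"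
  have \<kappa>: "\<kappa> j < d" "h (\<kappa> j) = j" for j
    using bij_betw_inv_into_right[OF h, of j] bij_betw_apply[OF bij_betw_inv_into[OF h], of j]
    by (auto simp: \<kappa>_def)
  have \<kappa>h: "\<kappa> (h k) = k" if "k < d" for k
    using that bij_betw_inv_into_left[OF h] by (auto simp: \<kappa>_def)
  have \<kappa>inj: "\<kappa> i = \<kappa> j \<longleftrightarrow> i = j" for i j
    by (metis \<kappa>(2))
  have d: "0 < d" by (simp add: d_def)
  \<comment> \<open>A fixed rotation \<open>R\<close> sends the first axis to the direction of
    \<open>u\<close>, as does every good frame matrix \<open>E A\<close>. Their quotient
    \<open>E A ** transpose R\<close> therefore fixes \<open>u\<close>.\<close>
  have "norm (axis (h 0) 1 :: real^'m) = norm (u /\<^sub>R norm u)"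
    using u by simp
  then obtain T :: "real^'m \<Rightarrow> real^'m" where T: "orthogonal_transformation T" "T (axis (h 0) 1) = u /\<^sub>R norm u"
    using orthogonal_transformation_exists by blast
  define R where "R = matrix T"
  have R: "orthogonal_matrix R" "linear T" "\<And>x. R *v x = T x" "\<And>x y. T x \<bullet> T y = x \<bullet> y"
    using T(1) unfolding R_def
    by (simp_all add: orthogonal_transformation_matrix matrix_works)
      (metis orthogonal_transformation_def T(1))
  have RTu: "transpose R *v u = norm u *\<^sub>R axis (h 0) 1"
  proof -
    have "u = R *v (norm u *\<^sub>R axis (h 0) 1)"
      using u R T(2) by (simp add: linear_scale)
    then have "transpose R *v u = (transpose R ** R) *v (norm u *\<^sub>R axis (h 0) 1)"
      by (metis matrix_vector_mul_assoc)
    then show ?thesis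
      using R(1) by (simp add: orthogonal_matrix)
  qed
  define a where "a A k = (if k = 0 then u else A $ h k)" for A :: "real^'m^'m" and k
  define good where "good A \<longleftrightarrow> (\<forall>k<d. gram_schmidt (a A) k \<noteq> 0)" for A
  define E where "E A = (\<chi> i j. gram_schmidt (a A) (\<kappa> j) $ i)" for A
  \<comment> \<open>The value \<open>mat 1\<close> at degenerate matrices keeps \<open>F\<close>
    inside the group everywhere; only good matrices will carry mass.\<close>
  define F where "F A = (if good A then E A ** transpose R else mat 1)" for A
  have E_axis: "E A *v axis j 1 = gram_schmidt (a A) (\<kappa> j)" for A j
    by (simp add: E_def vec_eq_iff matrix_vector_mult_basis column_def)
  have gs0: "gram_schmidt (a A) 0 = u /\<^sub>R norm u" for A
    by (subst gram_schmidt.simps) (simp add: a_def Let_def)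
  have FG: "F A \<in> G" for A
  proof (cases "good A")
    case True
    have "(transpose (E A) ** E A) $ i $ j = mat 1 $ i $ j" for i j
    proof -
      have "(transpose (E A) ** E A) $ i $ j = gram_schmidt (a A) (\<kappa> i) \<bullet> gram_schmidt (a A) (\<kappa> j)"
        by (simp add: matrix_matrix_mult_def transpose_def E_def inner_vec_def)
      also have "\<dots> = mat 1 $ i $ j"
        using True \<kappa>(1) by (subst gram_schmidt_orthonormal[of d]) (auto simp: good_def mat_def \<kappa>inj)
      finally show ?thesis .
    qed
    then have "orthogonal_matrix (E A)"
      by (simp add: orthogonal_matrix vec_eq_iff)
    then have "orthogonal_matrix (F A)"
      using R(1) True by (simp add: F_def orthogonal_matrix_mul orthogonal_matrix_transpose)
    moreover have "F A *v u = u"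
      using True u d by (simp add: F_def RTu matrix_vector_mult_scaleR E_axis \<kappa>h gs0
          del: transpose_matrix_vector flip: matrix_vector_mul_assoc)
    ultimately show ?thesis
      by (simp add: G_def symmetry_group_def)
  next
    case False
    then show ?thesis by (simp add: F_def G_def symmetry_group_one)
  qed
  have a_meas [measurable]: "(\<lambda>A. a A k) \<in> borel_measurable borel" for k
    unfolding a_def by (cases "k = 0") (auto intro!: borel_measurable_continuous_onI continuous_intros)
  have gs_meas [measurable]: "(\<lambda>A. gram_schmidt (a A) k) \<in> borel_measurable borel" for k
    by (rule borel_measurable_gram_schmidt) simp
  have [measurable]: "Measurable.pred borel good"
    unfolding good_def by measurable
  have "E \<in> borel_measurable borel"
    unfolding E_def
    by (intro borel_measurable_vec_lambda) (simp add: cart_eq_inner_axis)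
  then have "(\<lambda>A. E A ** transpose R) \<in> borel_measurable borel"
    by (rule measurable_compose) (intro borel_measurable_continuous_onI continuous_intros)
  then have F_borel: "F \<in> borel_measurable borel"
    unfolding F_def by measurable
  define A0 where "A0 = transpose R"
  \<comment> \<open>A bounded set, so that Lebesgue measure can be normalised on it, and one that
    depends only on the norm and on \<open>good\<close>, so that the group preserves it. The radius
    leaves room for a neighbourhood of \<open>A0\<close>, which gives positive measure.\<close>
  define \<Omega> where "\<Omega> = {A \<in> ball 0 (norm A0 + 1). good A}"
  have [measurable]: "\<Omega> \<in> sets borel"
    unfolding \<Omega>_def by measurable
  \<comment> \<open>The rows of \<open>A0\<close> are the columns of \<open>R\<close>, an
    orthonormal basis beginning with the direction of \<open>u\<close>; replacing the first one by
    \<open>u\<close> changes only its length.\<close>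
  have gsA0: "gram_schmidt (a A0) k \<noteq> 0" if "k < d" for k
  proof -
    have "gram_schmidt (a A0) k = T (axis (h k) 1)"
    proof (rule gram_schmidt_of_orthonormal[of d _ _ "\<lambda>k. if k = 0 then norm u else 1"])
      show "T (axis (h i) 1) \<bullet> T (axis (h j) 1) = (if i = j then 1 else 0)" if "i < d" "j < d" for i j
        using that \<kappa>h by (auto simp: R(4) inner_axis_axis) metis
      show "a A0 k = (if k = 0 then norm u else 1) *\<^sub>R T (axis (h k) 1)" for k
      proof (cases "k = 0")
        case True
        then show ?thesis
          using u T(2) by (simp add: a_def)
      next
        case False
        then show ?thesis
          using R(3)[of "axis (h k) 1", symmetric]
          by (simp add: a_def A0_def matrix_vector_mult_basis column_def transpose_def)
      qed
    qed (use u that in auto)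
    moreover have "T (axis (h k) 1) \<bullet> T (axis (h k) 1) = 1"
      by (simp add: R(4) inner_axis_axis)
    ultimately show ?thesis by auto
  qed
  have "\<forall>\<^sub>F A in nhds A0. gram_schmidt (a A) k \<noteq> 0" if "k < d" for k
  proof -
    have "isCont (\<lambda>A. a A j) A0" for j
      unfolding a_def by (cases "j = 0") (auto intro!: continuous_intros)
    then have "isCont (\<lambda>A. gram_schmidt (a A) k) A0"
      using that gsA0 by (intro isCont_gram_schmidt) auto
    then have "((\<lambda>A. gram_schmidt (a A) k) \<longlongrightarrow> gram_schmidt (a A0) k) (nhds A0)"
      using isCont_def tendsto_at_iff_tendsto_nhds by blast
    then show ?thesis
      using gsA0[OF that] tendsto_imp_eventually_ne by blast
  qed
  then have "\<forall>\<^sub>F A in nhds A0. good A"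
    unfolding good_def by (simp add: eventually_ball_finite flip: lessThan_iff Ball_def)
  moreover have "\<forall>\<^sub>F A in nhds A0. A \<in> ball 0 (norm A0 + 1)"
    by (intro eventually_nhds_in_open) auto
  ultimately have "\<forall>\<^sub>F A in nhds A0. A \<in> \<Omega>"
    by eventually_elim (simp add: \<Omega>_def)
  then obtain S where S: "open S" "A0 \<in> S" "S \<subseteq> \<Omega>"
    by (auto simp: eventually_nhds)
  then have "emeasure lborel S \<noteq> 0"
    using open_not_negligible[of S] by (auto simp: negligible_iff_emeasure0)
  then have pos: "emeasure lborel \<Omega> \<noteq> 0"
    using emeasure_mono[OF S(3), of lborel] by auto
  have fin: "emeasure lborel \<Omega> \<noteq> \<infinity>"
  proof -
    have "emeasure lborel \<Omega> \<le> emeasure lborel (ball (0::real^'m^'m) (norm A0 + 1))"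
      by (intro emeasure_mono) (auto simp: \<Omega>_def)
    then show ?thesis
      using emeasure_lborel_ball_finite[of "0::real^'m^'m" "norm A0 + 1"] by (auto simp: top_unique)
  qed
  define \<nu> where "\<nu> = uniform_measure lborel \<Omega>"
  have \<nu>: "prob_space \<nu>" "sets \<nu> = sets borel" "space \<nu> = UNIV"
    unfolding \<nu>_def using pos fin by (auto intro!: prob_space_uniform_measure)
  have Fm: "F \<in> measurable \<nu> (restrict_space borel G)"
    using F_borel FG \<nu> by (intro measurable_restrict_space2) (auto cong: measurable_cong_sets)
  define \<mu> where "\<mu> = distr \<nu> (restrict_space borel G) F"
  have sets_\<mu>: "sets \<mu> = sets (restrict_space borel G)"
    by (simp add: \<mu>_def)
  have closedG: "G \<in> sets borel"
    by (simp add: G_def closed_symmetry_group)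
  have em: "emeasure \<mu> B = emeasure lborel (\<Omega> \<inter> F -` B) / emeasure lborel \<Omega>" if "B \<in> sets \<mu>" for B
  proof -
    have B: "B \<in> sets borel"
      using that closedG by (auto simp: sets_\<mu> sets_restrict_space_iff)
    have "F -` B \<in> sets borel"
      using measurable_sets[OF F_borel B] by simp
    then show ?thesis
      using that Fm \<nu> unfolding \<mu>_def by (simp add: emeasure_distr \<nu>_def)
  qed
  have "distr \<mu> \<mu> (\<lambda>h. g ** h) = \<mu>" if g: "g \<in> G" for g
  proof (rule measure_eqI)
    fix B assume "B \<in> sets (distr \<mu> \<mu> (\<lambda>h. g ** h))"
    then have B: "B \<in> sets \<mu>" by simp
    have gm: "(\<lambda>h. g ** h) \<in> measurable \<mu> \<mu>"
      using g sets_\<mu> symmetry_group_measurable_mult unfolding G_def by blast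
    have space_\<mu>: "space \<mu> = G"
      by (simp add: \<mu>_def space_restrict_space)
    \<comment> \<open>Left multiplication by \<open>g\<close> lifts to an isometry of the matrix
      space: \<open>g\<close> rotates every row and leaves the prescribed first vector
      \<open>u\<close> alone, so it commutes with the frame construction.\<close>
    define \<rho> where "\<rho> g A = (\<chi> j. g *v (A $ j))" for g :: "real^'m^'m" and A :: "real^'m^'m"
    have a\<rho>: "a (\<rho> g A) = (\<lambda>k. g *v a A k)" if "g \<in> G" for g A
      using that by (auto simp: a_def \<rho>_def G_def symmetry_group_def)
    have orth: "orthogonal_transformation ((*v) g)" if "g \<in> G" for g
      using that by (simp add: G_def symmetry_group_def orthogonal_transformation_matrix)
    have gram_schmidt\<rho>: "gram_schmidt (a (\<rho> g A)) k = g *v gram_schmidt (a A) k" if "g \<in> G" for g A k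
      using gram_schmidt_orthogonal_transformation[OF orth[OF that]] by (simp add: a\<rho> that)
    have good\<rho>: "good (\<rho> g A) = good A" if "g \<in> G" for g A
    proof -
      have "g *v x = 0 \<longleftrightarrow> x = 0" for x
        using orthogonal_transformation_norm[OF orth[OF that], of x] by (metis norm_eq_zero)
      then show ?thesis
        using that by (simp add: good_def gram_schmidt\<rho>)
    qed
    have E\<rho>: "E (\<rho> g A) = g ** E A" if "g \<in> G" for g A
      using that by (simp add: E_def gram_schmidt\<rho> vec_eq_iff matrix_matrix_mult_def matrix_vector_mult_def)
    have o\<rho>: "orthogonal_transformation (\<rho> g)" if "g \<in> G" for g
      using that unfolding \<rho>_def by (intro orthogonal_transformation_rows) (simp add: G_def symmetry_group_def)
    have \<Omega>\<rho>: "\<rho> g A \<in> \<Omega> \<longleftrightarrow> A \<in> \<Omega>" if "g \<in> G" for g A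
      using that by (simp add: \<Omega>_def good\<rho> orthogonal_transformation_norm[OF o\<rho>])
    have F\<rho>: "F (\<rho> g A) = g ** F A" if "g \<in> G" "A \<in> \<Omega>" for g A
      using that by (simp add: F_def good\<rho> E\<rho> \<Omega>_def matrix_mul_assoc)
    have \<rho>\<rho>: "\<rho> g (\<rho> (transpose g) A) = A" for A
      using symmetry_group_inverse(2)[of g u] g
      by (simp add: \<rho>_def G_def matrix_vector_mul_assoc del: transpose_matrix_vector)
    have tg: "transpose g \<in> G"
      using g symmetry_group_transpose unfolding G_def by blast
    define C where "C = \<Omega> \<inter> F -` {h \<in> G. g ** h \<in> B}"
    have gB: "{h \<in> G. g ** h \<in> B} \<in> sets \<mu>"
      using measurable_sets[OF gm B] by (simp add: space_\<mu> vimage_def Int_def conj_commute)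
    have "{h \<in> G. g ** h \<in> B} \<in> sets borel"
      using gB closedG by (auto simp: sets_\<mu> sets_restrict_space_iff)
    from measurable_sets[OF F_borel this]
    have "F -` {h \<in> G. g ** h \<in> B} \<in> sets borel"
      by (simp only: space_borel Int_UNIV_right)
    then have C: "C \<in> sets borel"
      unfolding C_def by (intro sets.Int) simp_all
    have "\<rho> g ` C = \<Omega> \<inter> F -` B"
    proof (intro set_eqI iffI)
      fix A assume "A \<in> \<rho> g ` C"
      then show "A \<in> \<Omega> \<inter> F -` B"
        using g by (auto simp: C_def \<Omega>\<rho> F\<rho>)
    next
      fix A assume A: "A \<in> \<Omega> \<inter> F -` B"
      have "g ** (transpose g ** F A) = F A"
        using symmetry_group_inverse(2)[of g u] g by (simp add: matrix_mul_assoc G_def)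
      then have "\<rho> (transpose g) A \<in> C"
        using A tg FG[of "\<rho> (transpose g) A"] by (auto simp: C_def \<Omega>\<rho> F\<rho>)
      then show "A \<in> \<rho> g ` C"
        using \<rho>\<rho> by (metis imageI)
    qed
    then have "emeasure lborel C = emeasure lborel (\<Omega> \<inter> F -` B)"
      using emeasure_lborel_orthogonal_image[OF o\<rho>[OF g] C] by simp
    moreover have "emeasure (distr \<mu> \<mu> (\<lambda>h. g ** h)) B = emeasure \<mu> {h \<in> G. g ** h \<in> B}"
      using gm B by (simp add: emeasure_distr space_\<mu> vimage_def Int_def conj_commute)
    ultimately show "emeasure (distr \<mu> \<mu> (\<lambda>h. g ** h)) B = emeasure \<mu> B"
      using em[OF gB] em[OF B] by (simp add: C_def)
  qed simp
  moreover have "prob_space \<mu>"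
    unfolding \<mu>_def using \<nu>(1) Fm by (rule prob_space.prob_space_distr)
  ultimately show ?thesis
    using sets_\<mu> by blast
qed

text \<open>By Fubini, left invariance of \<open>\<mu>\<close> and \<open>\<nu>\<close> identifies \<open>\<mu>\<close> with the inversion of \<open>\<nu>\<close>.\<close>

lemma haar_eq_inverse:
  fixes u :: "real^'m"
  defines "G \<equiv> symmetry_group u"
  assumes "prob_space \<mu>" and sets_\<mu>: "sets \<mu> = sets (restrict_space borel G)"
    and inv_\<mu>: "\<And>g. g \<in> G \<Longrightarrow> distr \<mu> \<mu> (\<lambda>h. g ** h) = \<mu>"
    and "prob_space \<nu>" and sets_\<nu>: "sets \<nu> = sets (restrict_space borel G)"
    and inv_\<nu>: "\<And>g. g \<in> G \<Longrightarrow> distr \<nu> \<nu> (\<lambda>h. g ** h) = \<nu>"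
    and B: "B \<in> sets (restrict_space borel G)"
  shows "emeasure \<mu> B = (\<integral>\<^sup>+ h. indicator B (transpose h) \<partial>\<nu>)"
proof -
  interpret \<mu>: prob_space \<mu> by fact
  interpret \<nu>: prob_space \<nu> by fact
  interpret pair_sigma_finite \<nu> \<mu> ..
  have space: "space \<mu> = G" "space \<nu> = G"
    using sets_\<mu>[THEN sets_eq_imp_space_eq] sets_\<nu>[THEN sets_eq_imp_space_eq]
    by (auto simp: space_restrict_space)
  have "closed G"
    by (simp add: G_def closed_symmetry_group)
  then have [measurable]: "B \<in> sets borel"
    using B by (auto simp: sets_restrict_space_iff)
  have id [measurable]: "(\<lambda>h. h) \<in> borel_measurable \<mu>" "(\<lambda>h. h) \<in> borel_measurable \<nu>"
    using measurable_restrict_space1[OF measurable_ident_sets[OF refl], of borel G] sets_\<mu> sets_\<nu>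
    by (auto cong: measurable_cong_sets)
  have mult: "(\<lambda>h. g ** h) \<in> measurable \<mu> \<mu>" "(\<lambda>h. g ** h) \<in> measurable \<nu> \<nu>" if "g \<in> G" for g
    using that sets_\<mu> sets_\<nu> symmetry_group_measurable_mult unfolding G_def by blast+
  have [measurable]: "(\<lambda>h. transpose h) \<in> borel_measurable (borel :: (real^'m^'m) measure)"
    by (intro borel_measurable_continuous_onI continuous_intros)
  have "(\<lambda>x. fst x) \<in> borel_measurable (\<nu> \<Otimes>\<^sub>M \<mu>)" "(\<lambda>x. snd x) \<in> borel_measurable (\<nu> \<Otimes>\<^sub>M \<mu>)"
    using measurable_compose[OF measurable_fst id(2)] measurable_compose[OF measurable_snd id(1)] by auto
  then have [measurable]: "(\<lambda>x. transpose (fst x) ** snd x) \<in> borel_measurable (\<nu> \<Otimes>\<^sub>M \<mu>)"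
    by (rule borel_measurable_continuous_Pair) (intro continuous_intros)
  have pm: "(\<lambda>x. indicator B (transpose (fst x) ** snd x) :: ennreal) \<in> borel_measurable (\<nu> \<Otimes>\<^sub>M \<mu>)"
    by measurable
  have "emeasure \<mu> B = (\<integral>\<^sup>+ h. emeasure \<mu> B \<partial>\<nu>)"
    by (simp add: \<nu>.emeasure_space_1)
  also have "\<dots> = (\<integral>\<^sup>+ h. (\<integral>\<^sup>+ k. indicator B (transpose h ** k) \<partial>\<mu>) \<partial>\<nu>)"
  proof (rule nn_integral_cong)
    fix h assume "h \<in> space \<nu>"
    then have h: "transpose h \<in> G"
      using symmetry_group_transpose space unfolding G_def by blast
    have "emeasure \<mu> B = (\<integral>\<^sup>+ k. indicator B k \<partial>distr \<mu> \<mu> (\<lambda>k. transpose h ** k))"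
      using B inv_\<mu>[OF h] sets_\<mu> by simp
    also have "\<dots> = (\<integral>\<^sup>+ k. indicator B (transpose h ** k) \<partial>\<mu>)"
      using B sets_\<mu> by (intro nn_integral_distr mult h borel_measurable_indicator) auto
    finally show "emeasure \<mu> B = (\<integral>\<^sup>+ k. indicator B (transpose h ** k) \<partial>\<mu>)" .
  qed
  also have "\<dots> = (\<integral>\<^sup>+ k. (\<integral>\<^sup>+ h. indicator B (transpose h ** k) \<partial>\<nu>) \<partial>\<mu>)"
    using pm by (intro Fubini'[symmetric]) (simp add: case_prod_beta)
  also have "\<dots> = (\<integral>\<^sup>+ k. (\<integral>\<^sup>+ h. indicator B (transpose h) \<partial>\<nu>) \<partial>\<mu>)"
  proof (rule nn_integral_cong)
    fix k assume "k \<in> space \<mu>"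
    then have k: "transpose k \<in> G"
      using symmetry_group_transpose space unfolding G_def by blast
    \<comment> \<open>Inversion turns the right translation by \<open>k\<close> into a left
      translation, for which \<nu> is known to be invariant.\<close>
    have eq: "transpose h ** k = transpose (transpose k ** h)" for h
      by (simp add: matrix_transpose_mul)
    have m: "(\<lambda>h. indicator B (transpose h) :: ennreal) \<in> borel_measurable \<nu>"
      by (rule measurable_compose[OF id(2)]) measurable
    have "(\<integral>\<^sup>+ h. indicator B (transpose h) \<partial>\<nu>) = (\<integral>\<^sup>+ h. indicator B (transpose h) \<partial>distr \<nu> \<nu> (\<lambda>h. transpose k ** h))"
      using inv_\<nu>[OF k] by simp
    also have "\<dots> = (\<integral>\<^sup>+ h. indicator B (transpose (transpose k ** h)) \<partial>\<nu>)"
      using m by (intro nn_integral_distr mult k) simp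
    finally show "(\<integral>\<^sup>+ h. indicator B (transpose h ** k) \<partial>\<nu>) = (\<integral>\<^sup>+ h. indicator B (transpose h) \<partial>\<nu>)"
      by (simp only: eq)
  qed
  also have "\<dots> = (\<integral>\<^sup>+ h. indicator B (transpose h) \<partial>\<nu>)"
    by (simp add: \<mu>.emeasure_space_1)
  finally show ?thesis .
qed

text \<open>Uniqueness comes from comparing any candidate, and \<nu> itself, with the inversion of
  the same \<nu>: both are equal to it. The definite description is then legitimate.\<close>

lemma normalized_haar_symmetry_group:
  fixes u :: "real^'m"
  assumes u: "u \<noteq> 0"
  defines "\<mu> \<equiv> normalized_haar (symmetry_group u)"
  shows "prob_space \<mu>" and "sets \<mu> = sets (restrict_space borel (symmetry_group u))"
    and "\<And>g. g \<in> symmetry_group u \<Longrightarrow> distr \<mu> \<mu> (\<lambda>h. g ** h) = \<mu>"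
proof -
  let ?P = "\<lambda>\<mu>. prob_space \<mu> \<and> sets \<mu> = sets (restrict_space borel (symmetry_group u))
      \<and> (\<forall>g\<in>symmetry_group u. distr \<mu> \<mu> (\<lambda>h. g ** h) = \<mu>)"
  obtain \<nu> where \<nu>: "?P \<nu>"
    using haar_exists[OF u] by blast
  have uniq: "\<mu>' = \<nu>" if "?P \<mu>'" for \<mu>'
  proof (rule measure_eqI)
    fix B assume "B \<in> sets \<mu>'"
    then have B: "B \<in> sets (restrict_space borel (symmetry_group u))"
      using that by simp
    show "emeasure \<mu>' B = emeasure \<nu> B"
      using that \<nu> haar_eq_inverse[OF _ _ _ _ _ _ B, of \<mu>' \<nu>] haar_eq_inverse[OF _ _ _ _ _ _ B, of \<nu> \<nu>] by simp
  qed (use that \<nu> in simp)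
  have "\<mu> = \<nu>"
    unfolding \<mu>_def normalized_haar_def by (rule the_equality[of ?P, OF \<nu> uniq])
  with \<nu> have "?P \<mu>"
    by simp
  then show "prob_space \<mu>" "sets \<mu> = sets (restrict_space borel (symmetry_group u))"
    "\<And>g. g \<in> symmetry_group u \<Longrightarrow> distr \<mu> \<mu> (\<lambda>h. g ** h) = \<mu>"
    by auto
qed

section \<open>Symmetries of the ball and the second moment of a 2-design\<close>

lemma orthogonal_transformation_in_symmetry_group:
  assumes "orthogonal_transformation f" "f u = u"
  shows "matrix f \<in> symmetry_group u" "matrix f *v x = f x"
  using assms by (auto simp: symmetry_group_def orthogonal_transformation_matrix matrix_works)

text \<open>For \<open>d = 0\<close> the quotient is 0 and the map is the identity, so the statement
  carries no side condition.\<close>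

lemma orthogonal_transformation_reflection:
  "orthogonal_transformation (\<lambda>x. x - (2 * (d \<bullet> x) / (d \<bullet> d)) *\<^sub>R d)"
  unfolding orthogonal_transformation_def
proof (intro conjI allI)
  show "linear (\<lambda>x. x - (2 * (d \<bullet> x) / (d \<bullet> d)) *\<^sub>R d)"
    by (rule linearI) (auto simp: algebra_simps inner_simps add_divide_distrib)
  show "(v - (2 * (d \<bullet> v) / (d \<bullet> d)) *\<^sub>R d) \<bullet> (w - (2 * (d \<bullet> w) / (d \<bullet> d)) *\<^sub>R d) = v \<bullet> w" for v w
  proof -
    have "(v - a *\<^sub>R d) \<bullet> (w - b *\<^sub>R d) = v \<bullet> w - b * (d \<bullet> v) - a * (d \<bullet> w) + a * b * (d \<bullet> d)" for a b
      by (simp add: inner_diff_left inner_diff_right inner_commute[of v] algebra_simps)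
    then show ?thesis
      by (cases "d = 0") (simp_all add: inner_commute[of v])
  qed
qed

lemma card_1_imp_multiple:
  fixes u x :: "real^'m"
  assumes "CARD('m) = 1" "u \<noteq> 0"
  shows "\<exists>c. x = c *\<^sub>R u"
proof -
  have "dim {u} = DIM(real^'m)"
    using assms by simp
  then have "span {u} = UNIV"
    using dim_eq_full by blast
  then show ?thesis
    by (auto simp: span_singleton)
qed

text \<open>In dimension 1 the boundary sphere is empty and \<open>\<beta>\<close> is arbitrary.\<close>

lemma spherical_2_design_second_moment:
  fixes u :: "real^'m"
  assumes u: "u \<noteq> 0" and design: "spherical_design u 2 N p v"
  obtains \<beta> :: real where "0 < \<beta>" "CARD('m) = 1 \<or> \<beta> * (real CARD('m) - 1) = 1 / (u \<bullet> u)"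
    "\<And>x. (\<Sum>k<N. p k * (x \<bullet> v k)\<^sup>2) = ((x \<bullet> u) / (u \<bullet> u))\<^sup>2 + \<beta> * (x \<bullet> x - (x \<bullet> u)\<^sup>2 / (u \<bullet> u))"
proof (cases "CARD('m) = 1")
  case True
  note all = card_1_imp_multiple[OF True u]
  have "(\<Sum>k<N. p k * (x \<bullet> v k)\<^sup>2) = ((x \<bullet> u) / (u \<bullet> u))\<^sup>2 + 1 * (x \<bullet> x - (x \<bullet> u)\<^sup>2 / (u \<bullet> u))" for x
  proof -
    obtain c where c: "x = c *\<^sub>R u" using all by blast
    have "(\<Sum>k<N. p k * (x \<bullet> v k)\<^sup>2) = (\<Sum>k<N. p k) * c\<^sup>2"
      unfolding sum_distrib_right using design
      by (intro sum.cong) (auto simp: spherical_design_def c inner_commute)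
    then show ?thesis
      using design u by (auto simp: spherical_design_def c power2_eq_square)
  qed
  then show ?thesis
    using True that[of 1] by auto
next
  case False
  define G where "G = symmetry_group u"
  define \<mu> where "\<mu> = normalized_haar G"
  note haar = normalized_haar_symmetry_group[OF u, folded G_def, folded \<mu>_def]
  interpret prob_space \<mu> by (rule haar)
  have uu: "u \<bullet> u > 0" using u by simp
  have space: "space \<mu> = G"
    using haar(2)[THEN sets_eq_imp_space_eq] by (auto simp: space_restrict_space)
  have bm: "f \<in> borel_measurable \<mu>" if "continuous_on UNIV f" for f :: "real^'m^'m \<Rightarrow> real"
    using measurable_restrict_space1[OF borel_measurable_continuous_onI[OF that], of G] haar(2)
    by (auto cong: measurable_cong_sets)
  have card: "2 \<le> CARD('m)"
    using False zero_less_card_finite[where 'a='m] by linarith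
  obtain y0 where y0: "norm y0 = 1" "y0 \<bullet> u = 0"
  proof -
    obtain y where "y \<noteq> 0" "orthogonal u y"
      using card orthogonal_to_vector_exists[of u] by auto
    then show thesis
      by (intro that[of "y /\<^sub>R norm y"]) (auto simp: orthogonal_def inner_commute)
  qed
  \<comment> \<open>A point of the boundary sphere: the centre plus an orthogonal vector of length
    1/|u|. The condition in the definition of a design is evaluated at this point only.\<close>
  define w where "w = u /\<^sub>R (norm u)\<^sup>2 + y0 /\<^sub>R norm u"
  have y0y0: "y0 \<bullet> y0 = 1"
    using y0 by (simp add: norm_eq_sqrt_inner)
  have uy0: "u \<bullet> y0 = 0"
    using y0 by (simp add: inner_commute)
  have wu: "w \<bullet> u = 1"
    unfolding w_def inner_add_left inner_scaleR_left y0(2) power2_norm_eq_inner using uu by simp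
  then have uw: "u \<bullet> w = 1"
    by (simp add: inner_commute)
  have "w \<bullet> w = (w \<bullet> u) / (norm u)\<^sup>2 + (w \<bullet> y0) / norm u"
    by (subst (2) w_def) (simp add: inner_add_right divide_inverse mult.commute)
  also have "w \<bullet> y0 = 1 / norm u"
    unfolding w_def inner_add_left inner_scaleR_left uy0 y0y0 by (simp add: divide_inverse)
  finally have ww: "w \<bullet> w = 2 / (u \<bullet> u)"
    by (simp add: wu power2_norm_eq_inner[symmetric]) (simp add: power2_eq_square)
  have w: "w \<in> boundary_sphere u"
  proof -
    have "norm w = sqrt 2 / norm u"
      unfolding norm_eq_sqrt_inner[of w] ww norm_eq_sqrt_inner[of u] by (simp add: real_sqrt_divide)
    then show ?thesis
      using u uw by (simp add: boundary_sphere_def cone_fun_def divide_inverse)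
  qed
  define q where "q x = (\<integral>Q. (x \<bullet> (Q *v w))\<^sup>2 \<partial>\<mu>)" for x
  have Gorth: "(g *v x) \<bullet> (g *v y) = x \<bullet> y" if "g \<in> G" for g x y
    using that unfolding G_def symmetry_group_def
    by (metis (no_types, lifting) mem_Collect_eq orthogonal_transformation_def orthogonal_transformation_matrix matrix_vector_mul_linear matrix_of_matrix_vector_mul)
  have Gu: "g *v u = u" if "g \<in> G" for g
    using that unfolding G_def symmetry_group_def by simp
  have int: "integrable \<mu> f" if c: "continuous_on UNIV f" and b: "\<And>Q. Q \<in> G \<Longrightarrow> \<bar>f Q\<bar> \<le> B" for f :: "real^'m^'m \<Rightarrow> real" and B
    using bm[OF c] b space by (intro integrable_const_bound[of _ B]) auto
  have nQw: "norm (Q *v w) = norm w" if "Q \<in> G" for Q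
    using Gorth[OF that, of w w] by (simp add: norm_eq_sqrt_inner)
  have int1: "integrable \<mu> (\<lambda>Q. (x \<bullet> (Q *v w)) * (y \<bullet> (Q *v w)))" for x y
  proof (rule int)
    show "continuous_on UNIV (\<lambda>Q. (x \<bullet> (Q *v w)) * (y \<bullet> (Q *v w)))"
      by (intro continuous_intros)
    show "\<bar>(x \<bullet> (Q *v w)) * (y \<bullet> (Q *v w))\<bar> \<le> (norm x * norm w) * (norm y * norm w)" if "Q \<in> G" for Q
      using Cauchy_Schwarz_ineq2[of x "Q *v w"] Cauchy_Schwarz_ineq2[of y "Q *v w"] nQw[OF that]
      by (auto simp: abs_mult intro!: mult_mono)
  qed
  have int2: "integrable \<mu> (\<lambda>Q. (x \<bullet> (Q *v w))\<^sup>2)" for x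
    using int1[of x x] by (simp add: power2_eq_square)
  have q_design: "(\<Sum>k<N. p k * (x \<bullet> v k)\<^sup>2) = q x" for x
  proof -
    have ij: "(\<Sum>k<N. p k * (v k $ i * v k $ j)) = (\<integral>Q. (Q *v w) $ i * (Q *v w) $ j \<partial>\<mu>)" for i j
    proof -
      have "(\<Sum>k<N. p k * tensor_power 2 (v k) (\<lambda>n. if n = 0 then i else j)) =
        (\<integral>Q. tensor_power 2 (Q *v w) (\<lambda>n. if n = 0 then i else j) \<partial>\<mu>)"
        using design w unfolding spherical_design_def \<mu>_def G_def by blast
      then show ?thesis
        by (simp add: tensor_power_def numeral_2_eq_2)
    qed
    have exp: "(x \<bullet> z)\<^sup>2 = (\<Sum>i\<in>UNIV. \<Sum>j\<in>UNIV. (x$i * x$j) * (z$i * z$j))" for z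
      by (simp add: power2_eq_square inner_vec_def sum_product algebra_simps)
    have "(\<Sum>k<N. p k * (x \<bullet> v k)\<^sup>2) = (\<Sum>i\<in>UNIV. \<Sum>j\<in>UNIV. (x$i * x$j) * (\<Sum>k<N. p k * (v k $ i * v k $ j)))"
      unfolding exp sum_distrib_left
      by (subst sum.swap, rule sum.cong[OF refl], subst sum.swap, intro sum.cong refl) (simp add: algebra_simps)
    also have "\<dots> = (\<Sum>i\<in>UNIV. \<Sum>j\<in>UNIV. (x$i * x$j) * (\<integral>Q. (Q *v w) $ i * (Q *v w) $ j \<partial>\<mu>))"
      by (simp only: ij)
    also have "\<dots> = (\<integral>Q. (\<Sum>i\<in>UNIV. \<Sum>j\<in>UNIV. (x$i * x$j) * ((Q *v w) $ i * (Q *v w) $ j)) \<partial>\<mu>)"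
      using int1[of "axis _ 1" "axis _ 1"] by (subst Bochner_Integration.integral_sum | simp add: inner_axis' )+
    finally show ?thesis
      by (simp add: q_def exp)
  qed
  have q_inv: "q (g *v x) = q x" if g: "g \<in> G" for g x
  proof -
    have gg: "g ** transpose g = mat 1" and tg: "transpose g \<in> G"
      using g symmetry_group_inverse symmetry_group_transpose unfolding G_def by blast+
    have eq: "(g *v x) \<bullet> (Q *v w) = x \<bullet> ((transpose g ** Q) *v w)" for Q
      using dot_lmul_matrix[of x "transpose g" "Q *v w"]
      unfolding matrix_vector_mul_assoc[symmetric] vector_transpose_matrix .
    have "q x = (\<integral>Q. (x \<bullet> (Q *v w))\<^sup>2 \<partial>distr \<mu> \<mu> (\<lambda>Q. transpose g ** Q))"
      using haar(3)[OF tg] by (simp add: q_def)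
    also have "\<dots> = (\<integral>Q. (x \<bullet> ((transpose g ** Q) *v w))\<^sup>2 \<partial>\<mu>)"
      using tg haar(2) symmetry_group_measurable_mult unfolding G_def
      by (intro integral_distr bm continuous_intros) (auto simp: G_def)
    finally show ?thesis
      by (simp add: q_def eq)
  qed
  \<comment> \<open>The negated reflection in \<open>u\<close> fixes \<open>u\<close> and reverses
    its orthogonal complement. Averaging over the two signs of \<open>y\<close> removes the cross
    term, and \<open>u \<bullet> (Q *v w) = 1\<close> evaluates the part along
    \<open>u\<close>.\<close>
  have q_split: "q (s *\<^sub>R u + y) = s\<^sup>2 + q y" if y: "y \<bullet> u = 0" for s y
  proof -
    have "orthogonal_transformation (\<lambda>x. - (x - (2 * (u \<bullet> x) / (u \<bullet> u)) *\<^sub>R u))" (is "orthogonal_transformation ?f")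
      using orthogonal_transformation_reflection by (simp only: orthogonal_transformation_neg)
    moreover have "?f u = u"
      using u by (simp add: scaleR_2)
    ultimately have "matrix ?f \<in> G" and fx: "\<And>x. matrix ?f *v x = ?f x"
      using orthogonal_transformation_in_symmetry_group[of ?f u] unfolding G_def by blast+
    from q_inv[OF this(1), of "s *\<^sub>R u + y"]
    have "q (?f (s *\<^sub>R u + y)) = q (s *\<^sub>R u + y)"
      unfolding fx .
    moreover have "?f (s *\<^sub>R u + y) = s *\<^sub>R u - y"
    proof -
      have "2 * (u \<bullet> (s *\<^sub>R u + y)) / (u \<bullet> u) = s + s"
        using u y by (simp add: inner_add_right inner_commute)
      then show ?thesis
        by (simp only: scaleR_add_left) simp
    qed
    ultimately have eq: "q (s *\<^sub>R u - y) = q (s *\<^sub>R u + y)" by (simp only:)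
    have uQ: "u \<bullet> (Q *v w) = 1" if "Q \<in> G" for Q
      using Gorth[OF that, of u w] Gu[OF that] uw by simp
    have "q (s *\<^sub>R u + y) + q (s *\<^sub>R u - y) = (\<integral>Q. ((s *\<^sub>R u + y) \<bullet> (Q *v w))\<^sup>2 + ((s *\<^sub>R u - y) \<bullet> (Q *v w))\<^sup>2 \<partial>\<mu>)"
      unfolding q_def by (intro Bochner_Integration.integral_add[symmetric] int2)
    also have "\<dots> = (\<integral>Q. 2 * s\<^sup>2 + 2 * (y \<bullet> (Q *v w))\<^sup>2 \<partial>\<mu>)"
      using space uQ by (intro Bochner_Integration.integral_cong refl)
        (simp add: inner_add_left inner_diff_left power2_eq_square algebra_simps)
    also have "\<dots> = 2 * s\<^sup>2 + 2 * q y"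
      unfolding q_def using int2[of y] by (simp add: prob_space)
    finally show ?thesis using eq by simp
  qed
  define \<beta> where "\<beta> = q y0"
  \<comment> \<open>Two vectors of equal length orthogonal to \<open>u\<close> are exchanged by the
    reflection in their difference, which fixes \<open>u\<close>. So \<open>q\<close> depends only
    on the length there, and \<beta> is its value at unit length.\<close>
  have q_perp: "q y = \<beta> * (y \<bullet> y)" if y: "y \<bullet> u = 0" for y
  proof -
    define z where "z = norm y *\<^sub>R y0"
    define d where "d = z - y"
    let ?f = "\<lambda>x. x - (2 * (d \<bullet> x) / (d \<bullet> d)) *\<^sub>R d"
    have du: "d \<bullet> u = 0"
      by (simp add: d_def z_def inner_diff_left y y0)
    have zz: "z \<bullet> z = y \<bullet> y"
      by (simp add: z_def y0y0 power2_eq_square[symmetric] power2_norm_eq_inner)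
    have "?f z = y"
    proof (cases "d = 0")
      case True
      then show ?thesis by (simp add: d_def)
    next
      case False
      have "2 * (d \<bullet> z) = d \<bullet> d"
        using zz by (simp add: d_def inner_diff_left inner_diff_right inner_commute)
      then show ?thesis
        using False by (simp add: d_def)
    qed
    have f: "orthogonal_transformation ?f" "?f u = u"
      using orthogonal_transformation_reflection du by auto
    then have "matrix ?f \<in> G" and fz: "matrix ?f *v z = y"
      using orthogonal_transformation_in_symmetry_group[OF f] \<open>?f z = y\<close> unfolding G_def by auto
    from q_inv[OF this(1), of z] have "q y = q z"
      unfolding fz .
    also have "\<dots> = (\<integral>Q. (norm y)\<^sup>2 * (y0 \<bullet> (Q *v w))\<^sup>2 \<partial>\<mu>)"
      by (simp add: q_def z_def power_mult_distrib)
    also have "\<dots> = \<beta> * (y \<bullet> y)"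
      by (simp add: \<beta>_def q_def power2_norm_eq_inner)
    finally show ?thesis .
  qed
  have q_eq: "q x = ((x \<bullet> u) / (u \<bullet> u))\<^sup>2 + \<beta> * (x \<bullet> x - (x \<bullet> u)\<^sup>2 / (u \<bullet> u))" for x
  proof -
    define s where "s = (x \<bullet> u) / (u \<bullet> u)"
    define y where "y = x - s *\<^sub>R u"
    have y: "y \<bullet> u = 0"
      using u by (simp add: y_def s_def inner_diff_left)
    have yy: "y \<bullet> y = x \<bullet> x - (x \<bullet> u)\<^sup>2 / (u \<bullet> u)"
    proof -
      have "y \<bullet> y = x \<bullet> x - 2 * s * (x \<bullet> u) + s * s * (u \<bullet> u)"
        by (simp add: y_def inner_diff_left inner_diff_right inner_commute[of u x] algebra_simps)
      moreover have "s * (u \<bullet> u) = x \<bullet> u"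
        using u by (simp add: s_def)
      ultimately show ?thesis
        by (simp add: s_def power2_eq_square mult.assoc)
    qed
    show ?thesis
      using q_split[OF y, of s] q_perp[OF y] yy by (simp add: y_def s_def)
  qed
  \<comment> \<open>The trace determines \<beta>: summed over the axes, \<open>q\<close> averages
    the constant squared norm of the orbit of \<open>w\<close>.\<close>
  have "(\<Sum>i\<in>UNIV. q (axis i 1)) = (\<integral>Q. (\<Sum>i\<in>UNIV. (axis i 1 \<bullet> (Q *v w))\<^sup>2) \<partial>\<mu>)"
    unfolding q_def by (intro Bochner_Integration.integral_sum[symmetric] int2)
  also have "\<dots> = (\<integral>Q. w \<bullet> w \<partial>\<mu>)"
  proof (intro Bochner_Integration.integral_cong refl)
    fix Q assume "Q \<in> space \<mu>"
    then have "(Q *v w) \<bullet> (Q *v w) = w \<bullet> w"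
      using Gorth space by blast
    then show "(\<Sum>i\<in>UNIV. (axis i 1 \<bullet> (Q *v w))\<^sup>2) = w \<bullet> w"
      by (simp add: inner_axis' inner_vec_def[of "Q *v w"] power2_eq_square)
  qed
  finally have tr: "(\<Sum>i\<in>UNIV. q (axis i 1)) = 2 / (u \<bullet> u)"
    by (simp add: ww prob_space)
  have sq: "(\<Sum>i\<in>UNIV. (u$i)\<^sup>2) = u \<bullet> u"
    by (simp add: inner_vec_def power2_eq_square)
  have "(\<Sum>i\<in>UNIV. q (axis i 1)) = (\<Sum>i\<in>UNIV. (u$i)\<^sup>2) / (u \<bullet> u)\<^sup>2 + \<beta> * (CARD('m) - (\<Sum>i\<in>UNIV. (u$i)\<^sup>2) / (u \<bullet> u))"
    unfolding q_eq
    by (simp add: inner_axis' sum.distrib sum_divide_distrib sum_subtractf power_divide flip: sum_distrib_left)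
  also have "\<dots> = 1 / (u \<bullet> u) + \<beta> * (real CARD('m) - 1)"
    using u unfolding sq by (simp add: power2_eq_square)
  finally have \<beta>: "\<beta> * (real CARD('m) - 1) = 1 / (u \<bullet> u)"
    using tr by simp
  then have "0 < \<beta> * (real CARD('m) - 1)"
    using uu by simp
  then have "0 < \<beta>"
    using card by (simp add: zero_less_mult_iff)
  show ?thesis
  proof (rule that[OF \<open>0 < \<beta>\<close>])
    show "CARD('m) = 1 \<or> \<beta> * (real CARD('m) - 1) = 1 / (u \<bullet> u)"
      using \<beta> by blast
    show "(\<Sum>k<N. p k * (x \<bullet> v k)\<^sup>2) = ((x \<bullet> u) / (u \<bullet> u))\<^sup>2 + \<beta> * (x \<bullet> x - (x \<bullet> u)\<^sup>2 / (u \<bullet> u))" for x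
      unfolding q_design by (rule q_eq)
  qed
qed

subsection \<open>The determinant bound\<close>

lemma norm_matrix_rows: "(norm A)\<^sup>2 = (\<Sum>i\<in>UNIV. (norm (A $ i))\<^sup>2)" for A :: "real^'m^'n"
  by (simp add: power2_norm_eq_inner inner_vec_def[of A])

lemma det_scaleR: "det (t *\<^sub>R A) = t ^ CARD('n) * det A" for A :: "real^'n^'n"
proof -
  have "t *\<^sub>R A = (\<chi> i. t *s A $ i)"
    by (simp add: vec_eq_iff)
  then show ?thesis
    by (simp add: det_rows_mul)
qed

lemma continuous_on_det: "continuous_on S (\<lambda>A :: real^'n^'n. det A)"
  unfolding det_def by (intro continuous_intros)

text \<open>A maximiser of \<open>\<bar>det\<bar>\<close> on the Frobenius ball is orthogonal: otherwise a row operation or a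
  volume-preserving rescaling of two rows decreases the norm, leaving room to increase the determinant.\<close>

lemma max_det_imp_orthogonal:
  fixes A :: "real^'n^'n"
  assumes A: "(norm A)\<^sup>2 \<le> CARD('n)" "det A \<noteq> 0"
    and max: "\<And>C :: real^'n^'n. (norm C)\<^sup>2 \<le> CARD('n) \<Longrightarrow> \<bar>det C\<bar> \<le> \<bar>det A\<bar>"
  shows "orthogonal_matrix A"
proof -
  \<comment> \<open>A matrix strictly inside the ball could be scaled up to its boundary, which
    would raise the determinant above the maximum.\<close>
  have improve: "CARD('n) \<le> (norm C)\<^sup>2" if C: "\<bar>det C\<bar> = \<bar>det A\<bar>" for C :: "real^'n^'n"
  proof (rule ccontr)
    assume "\<not> CARD('n) \<le> (norm C)\<^sup>2"
    then have lt: "(norm C)\<^sup>2 < CARD('n)" by simp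
    have "det (0 :: real^'n^'n) = 0"
      using det_0 by (metis mat_0 )
    then have C0: "norm C > 0"
      using C A(2) by auto
    define t where "t = sqrt (CARD('n)) / norm C"
    have "t > 1"
      using lt C0 real_less_rsqrt by (simp add: t_def)
    then have "1 < t ^ CARD('n)"
      by (simp add: one_less_power)
    moreover have "(norm (t *\<^sub>R C))\<^sup>2 = CARD('n)"
      using C0 by (simp add: t_def)
    then have "\<bar>det (t *\<^sub>R C)\<bar> \<le> \<bar>det A\<bar>"
      by (intro max) simp
    then have "t ^ CARD('n) * \<bar>det A\<bar> \<le> 1 * \<bar>det A\<bar>"
      using \<open>t > 1\<close> C by (simp add: det_scaleR abs_mult)
    ultimately show False
      using A(2) by (simp only: mult_le_cancel_right) auto
  qed
  have n: "(norm A)\<^sup>2 = CARD('n)"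
    using A(1) improve[of A] by simp
  have row_nz: "A $ i \<noteq> 0" for i
    using A(2) det_zero_row[of i A] by (auto simp: row_def vec_eq_iff)
  have split: "(norm C)\<^sup>2 = (norm (C $ i))\<^sup>2 + (norm (C $ j))\<^sup>2 + (\<Sum>k\<in>UNIV - {i, j}. (norm (C $ k))\<^sup>2)"
    if "i \<noteq> j" for i j and C :: "real^'n^'n"
    using that by (simp add: norm_matrix_rows sum.remove[of UNIV i] sum.remove[of "UNIV - {i}" j] Diff_insert2[symmetric])
  have orth: "A $ i \<bullet> A $ j = 0" if ij: "i \<noteq> j" for i j
  proof -
    \<comment> \<open>The coefficient for which the new row \<open>i\<close> becomes orthogonal to
      row \<open>j\<close>, the shortest vector obtainable by this row operation.\<close>
    define c where "c = - (A $ i \<bullet> A $ j) / (A $ j \<bullet> A $ j)"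
    define C where "C = (\<chi> k. if k = i then row i A + c *s row j A else row k A)"
    have "det C = det A"
      unfolding C_def by (rule det_row_operation[OF ij])
    then have "(norm A)\<^sup>2 \<le> (norm C)\<^sup>2"
      using improve[of C] n by simp
    then have le: "(norm (A $ i))\<^sup>2 \<le> (norm (A $ i + c *\<^sub>R A $ j))\<^sup>2"
      using ij by (simp add: split[OF ij] C_def row_def scalar_mult_eq_scaleR)
    have "c * (A $ j \<bullet> A $ j) = - (A $ i \<bullet> A $ j)"
      using row_nz[of j] by (simp add: c_def)
    moreover have "(norm (A $ i + c *\<^sub>R A $ j))\<^sup>2 = (norm (A $ i))\<^sup>2 + c * (A $ i \<bullet> A $ j) + c * (A $ i \<bullet> A $ j + c * (A $ j \<bullet> A $ j))"
      unfolding power2_norm_eq_inner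
      by (simp add: inner_add_left inner_add_right inner_commute[of "A $ j" "A $ i"] algebra_simps)
    ultimately have "0 \<le> c * (A $ i \<bullet> A $ j)"
      using le by simp
    also have "\<dots> = - ((A $ i \<bullet> A $ j)\<^sup>2 / (A $ j \<bullet> A $ j))"
      by (simp add: c_def power2_eq_square)
    finally have "(A $ i \<bullet> A $ j)\<^sup>2 / (A $ j \<bullet> A $ j) \<le> 0"
      by simp
    moreover have "A $ j \<bullet> A $ j > 0"
      using row_nz[of j] by simp
    ultimately show ?thesis
      by (auto simp: divide_le_0_iff)
  qed
  have eqn: "norm (A $ i) = norm (A $ j)" for i j
  proof (cases "i = j")
    case False
    define a b where "a = norm (A $ i)" and "b = norm (A $ j)"
    have ab: "a > 0" "b > 0"
      using row_nz by (auto simp: a_def b_def)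
    \<comment> \<open>The two factors have product 1 and give both rows the common length sqrt (a
      b). The comparison of norms becomes a^2 + b^2 \<le> 2 a b.\<close>
    define c where "c k = (if k = i then sqrt (b / a) else if k = j then sqrt (a / b) else 1)" for k
    define C where "C = (\<chi> k. c k *s A $ k)"
    have "prod c UNIV = c i * (c j * (\<Prod>k\<in>UNIV - {i} - {j}. c k))"
      using False by (simp add: prod.remove[of UNIV i] prod.remove[of "UNIV - {i}" j])
    also have "(\<Prod>k\<in>UNIV - {i} - {j}. c k) = 1"
      by (rule prod.neutral) (auto simp: c_def)
    also have "c i * (c j * 1) = 1"
      using ab False by (simp add: c_def flip: real_sqrt_mult)
    finally have "det C = det A"
      by (simp add: C_def det_rows_mul)
    then have "(norm A)\<^sup>2 \<le> (norm C)\<^sup>2"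
      using improve[of C] n by simp
    then have "a\<^sup>2 + b\<^sup>2 \<le> (sqrt (b / a) * a)\<^sup>2 + (sqrt (a / b) * b)\<^sup>2"
      using False ab by (simp add: split[OF False] C_def c_def scalar_mult_eq_scaleR a_def b_def)
    also have "\<dots> = 2 * a * b"
      using ab by (simp add: power_mult_distrib) (simp add: power2_eq_square)
    finally have "(a - b)\<^sup>2 \<le> 0"
      by (simp add: power2_diff)
    then show ?thesis
      by (simp add: a_def b_def)
  qed simp
  have one: "norm (A $ i) = 1" for i
  proof -
    have "(norm A)\<^sup>2 = (\<Sum>k\<in>(UNIV :: 'n set). (norm (A $ i))\<^sup>2)"
      unfolding norm_matrix_rows using eqn by (intro sum.cong refl) metis
    then have "(norm (A $ i))\<^sup>2 = 1"
      using n by simp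
    then show ?thesis
      using norm_ge_zero[of "A $ i"] power2_eq_1_iff[of "norm (A $ i)"] by linarith
  qed
  show ?thesis
    unfolding orthogonal_matrix_orthonormal_rows using one orth
    by (auto simp: row_def orthogonal_def)
qed

text \<open>By compactness the absolute determinant attains its maximum on the Frobenius ball. The
  identity lies in that ball, so a maximiser is invertible, hence orthogonal, and the maximum is 1;
  a matrix reaching 1 is then itself a maximiser.\<close>

lemma det_le_1:
  fixes A :: "real^'n^'n"
  assumes A: "(norm A)\<^sup>2 \<le> CARD('n)"
  shows "\<bar>det A\<bar> \<le> 1" and "\<bar>det A\<bar> = 1 \<Longrightarrow> orthogonal_matrix A"
proof -
  define B where "B = {A :: real^'n^'n. (norm A)\<^sup>2 \<le> CARD('n)}"
  have eq: "B = cball 0 (sqrt (CARD('n)))"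
  proof -
    have "(norm A)\<^sup>2 \<le> CARD('n) \<longleftrightarrow> norm A \<le> sqrt (CARD('n))" for A :: "real^'n^'n"
      using real_sqrt_le_iff[of "(norm A)\<^sup>2" "CARD('n)"] by simp
    then show ?thesis
      by (simp only: B_def set_eq_iff mem_Collect_eq mem_cball_0 simp_thms)
  qed
  have id: "mat 1 \<in> B"
  proof -
    have "norm (mat 1 $ i :: real^'n) = 1" for i
    proof -
      have "(mat 1 $ i :: real^'n) = axis i 1"
        by (simp add: mat_def axis_def vec_eq_iff)
      then show ?thesis by simp
    qed
    then show ?thesis
      by (simp add: B_def norm_matrix_rows)
  qed
  have "\<exists>A0\<in>B. \<forall>C\<in>B. \<bar>det C\<bar> \<le> \<bar>det A0\<bar>"
    using id unfolding eq by (intro continuous_attains_sup continuous_on_rabs continuous_on_det) auto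
  then obtain A0 where A0: "A0 \<in> B" "\<And>C. C \<in> B \<Longrightarrow> \<bar>det C\<bar> \<le> \<bar>det A0\<bar>"
    by blast
  have "\<bar>det A0\<bar> \<ge> 1"
    using A0(2)[OF id] by simp
  then have "orthogonal_matrix A0"
    using A0 by (intro max_det_imp_orthogonal) (auto simp: B_def)
  then have 1: "\<bar>det A0\<bar> = 1"
    using det_orthogonal_matrix by fastforce
  then show "\<bar>det A\<bar> \<le> 1"
    using A0(2)[of A] A by (simp add: B_def)
  show "orthogonal_matrix A" if "\<bar>det A\<bar> = 1"
    using A that 1 A0(2) by (intro max_det_imp_orthogonal) (auto simp: B_def)
qed

section \<open>Shears and John's inequality\<close>

lemma rank_one_update_mult:
  fixes a b x :: "real^'n"
  shows "(\<chi> i j. (if i = j then 1 else 0) + t * (a $ i * b $ j)) *v x = x + (t * (b \<bullet> x)) *\<^sub>R a"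
proof -
  have "(\<Sum>j\<in>UNIV. ((if i = j then 1 else 0) + t * (a $ i * b $ j)) * x $ j)
      = (\<Sum>j\<in>UNIV. (if i = j then x $ j else 0) + t * a $ i * (b $ j * x $ j))" for i
    by (rule sum.cong) (auto simp: algebra_simps)
  then show ?thesis
    by (simp add: vec_eq_iff matrix_vector_mult_def sum.distrib inner_vec_def flip: sum_distrib_left)
qed

text \<open>The reflection in \<open>d\<close> conjugates the shear \<open>x \<mapsto> x + (u \<bullet> x) d\<close> into its inverse.\<close>

lemma abs_det_shear:
  fixes u d :: "real^'n"
  assumes "u \<bullet> d = 0"
  shows "\<bar>det (\<chi> i j. (if i = j then 1 else 0) + d $ i * u $ j)\<bar> = 1"
proof (cases "d = 0")
  case True
  then show ?thesis
    using det_I[where 'a=real and 'n='n] by (simp add: mat_def)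
next
  case False
  define S where "S t = (\<chi> i j. (if i = j then 1 else 0) + t * (d $ i * u $ j) :: real^'n^'n)" for t
  define D where "D = (\<chi> i j. (if i = j then 1 else 0) - 2 / (d \<bullet> d) * (d $ i * d $ j) :: real^'n^'n)"
  have S: "S t *v x = x + (t * (u \<bullet> x)) *\<^sub>R d" for t x
    unfolding S_def by (rule rank_one_update_mult)
  have D: "D *v x = x + (- 2 / (d \<bullet> d) * (d \<bullet> x)) *\<^sub>R d" for x
    unfolding D_def using rank_one_update_mult[of "- 2 / (d \<bullet> d)" d d x] by simp
  have du: "d \<bullet> u = 0"
    using assms by (simp add: inner_commute)
  have "(D ** S t) *v x = (S (- t) ** D) *v x" for t x
  proof -
    have "u \<bullet> (D *v x) = u \<bullet> x"
      by (simp add: D inner_add_right inner_diff_right assms)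
    moreover have "D *v d = - d"
      using False by (simp add: D) (simp add: scaleR_2 flip: scaleR_minus_left)
    ultimately show ?thesis
      by (simp add: S matrix_vector_right_distrib matrix_vector_mult_scaleR flip: matrix_vector_mul_assoc)
  qed
  then have DS: "D ** S t = S (- t) ** D" for t
    by (simp add: matrix_eq)
  have "(D ** D) *v x = mat 1 *v x" for x
  proof -
    have "d \<bullet> (D *v x) = - (d \<bullet> x)"
      using False by (simp add: D inner_add_right inner_diff_right)
    then show ?thesis
      by (simp add: D[of "D *v x"] flip: matrix_vector_mul_assoc) (simp add: D)
  qed
  then have "D ** D = mat 1"
    by (subst matrix_eq) blast
  then have "det D * det D = 1"
    by (metis det_I det_mul)
  then have detD: "det D \<noteq> 0"
    by auto
  have "(S 1 ** S (- 1)) *v x = mat 1 *v x" for x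
    by (simp add: S inner_add_right inner_diff_right assms flip: matrix_vector_mul_assoc)
  then have "S 1 ** S (- 1) = mat 1"
    by (subst matrix_eq) blast
  then have "det (S 1) * det (S (- 1)) = 1"
    by (metis det_I det_mul)
  moreover have "det (S 1) = det (S (- 1))"
    using arg_cong[OF DS[of 1], of det] detD by (simp add: det_mul)
  ultimately have "(det (S 1))\<^sup>2 = 1"
    by (simp add: power2_eq_square)
  then show ?thesis
    by (auto simp: S_def power2_eq_1_iff)
qed

text \<open>\<open>G\<close> is the inverse of the map whose image of the ball contains the design. Averaging
  \<open>\<bar>G v\<bar>\<^sup>2\<close> over the design bounds the Frobenius norm of \<open>G\<close>, corrected by a shear so that it fixes \<open>u\<close>.\<close>

lemma john_inequality:
  fixes G :: "real^'m^'m" and u :: "real^'m"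
  assumes u: "u \<noteq> 0" and G: "\<And>x. u \<bullet> (G *v x) = u \<bullet> x"
    and \<beta>: "0 < \<beta>" "CARD('m) = 1 \<or> \<beta> * (real CARD('m) - 1) = 1 / (u \<bullet> u)"
    and p: "\<And>k. k < N \<Longrightarrow> 0 \<le> p k" "(\<Sum>k<N. p k) = 1"
    and mom: "\<And>x. (\<Sum>k<N. p k * (x \<bullet> v k)\<^sup>2) = ((x \<bullet> u) / (u \<bullet> u))\<^sup>2 + \<beta> * (x \<bullet> x - (x \<bullet> u)\<^sup>2 / (u \<bullet> u))"
    and Gv: "\<And>k. k < N \<Longrightarrow> (norm (G *v v k))\<^sup>2 \<le> 2 / (u \<bullet> u)"
  shows "\<bar>det G\<bar> \<le> 1" and "\<bar>det G\<bar> = 1 \<Longrightarrow> G \<in> symmetry_group u"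
proof -
  define D where "D = u \<bullet> u"
  have D: "D > 0" using u by (simp add: D_def)
  have "\<bar>det G\<bar> \<le> 1 \<and> (\<bar>det G\<bar> = 1 \<longrightarrow> G \<in> symmetry_group u)"
  proof (cases "CARD('m) = 1")
    case True
    note all = card_1_imp_multiple[OF True u]
    obtain c where c: "G *v u = c *\<^sub>R u"
      using all by blast
    have "c = 1"
      using G[of u] u by (simp add: c)
    have "G *v x = mat 1 *v x" for x
      using all[of x] c \<open>c = 1\<close> by (auto simp: matrix_vector_mult_scaleR)
    then have "G = mat 1"
      by (subst matrix_eq) blast
    then show ?thesis
      by (simp add: symmetry_group_def orthogonal_matrix_id)
  next
    case False
    with \<beta> have m: "\<beta> * (real CARD('m) - 1) = 1 / D"
      by (simp add: D_def)
    define e where "e = (norm (G *v u - u))\<^sup>2"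
    \<comment> \<open>Chosen so that the shear x \<mapsto> x + (u \<bullet> x) \<delta> carries
      \<open>G *v u\<close> back to \<open>u\<close>; here \<open>u \<bullet> (G *v u) = D\<close>
      is used. The number \<open>e\<close> measures the displacement being undone.\<close>
    define \<delta> where "\<delta> = (u - G *v u) /\<^sub>R D"
    define S where "S = (\<chi> i j. (if i = j then 1 else 0) + \<delta> $ i * u $ j :: real^'m^'m)"
    define H where "H = S ** G"
    have "u \<bullet> \<delta> = 0"
      by (simp add: \<delta>_def inner_diff_right G)
    then have detS: "\<bar>det S\<bar> = 1"
      unfolding S_def by (rule abs_det_shear)
    have detH: "\<bar>det H\<bar> = \<bar>det G\<bar>"
      by (simp add: H_def det_mul abs_mult detS)
    have uG: "(\<Sum>i\<in>UNIV. u $ i * G $ i $ j) = u $ j" for j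
    proof -
      have "u \<bullet> column j G = u $ j"
        using G[of "axis j 1"] by (simp add: matrix_vector_mult_basis inner_axis)
      then show ?thesis
        by (simp add: column_def inner_vec_def)
    qed
    have Hrow: "H $ i = G $ i + \<delta> $ i *\<^sub>R u" for i
      unfolding H_def S_def matrix_matrix_mult_def vec_eq_iff
      by (simp add: distrib_right sum.distrib if_distrib[of "\<lambda>x. x * _"] mult.assoc uG cong: if_cong flip: sum_distrib_left)
    have Gi: "G $ i \<bullet> x = (G *v x) $ i" for i x
      by (simp add: matrix_vector_mul_component)
    have GuGu: "(G *v u) \<bullet> (G *v u) = e + D"
      using G[of u] unfolding e_def power2_norm_eq_inner D_def
      by (simp add: inner_diff_left inner_diff_right inner_commute[of "G *v u" u])
    have "(norm H)\<^sup>2 = (\<Sum>i\<in>UNIV. (norm (G $ i))\<^sup>2 + 2 * (\<delta> $ i * (G *v u) $ i) + D * (\<delta> $ i * \<delta> $ i))"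
      unfolding norm_matrix_rows Hrow power2_norm_eq_inner
      by (rule sum.cong) (auto simp: inner_add_left inner_add_right inner_commute[of u "G $ _"] D_def Gi algebra_simps)
    also have "\<dots> = (norm G)\<^sup>2 + 2 * (\<delta> \<bullet> (G *v u)) + D * (\<delta> \<bullet> \<delta>)"
      by (simp add: sum.distrib norm_matrix_rows[of G] inner_vec_def[of \<delta>] sum_distrib_left)
    also have "\<delta> \<bullet> (G *v u) = - e / D"
      using G[of u] by (simp add: \<delta>_def inner_diff_left GuGu flip: D_def)
        (simp add: divide_inverse)
    also have "\<delta> \<bullet> \<delta> = e / D\<^sup>2"
    proof -
      have "e = (u - G *v u) \<bullet> (u - G *v u)"
        by (simp add: e_def power2_norm_eq_inner[symmetric] norm_minus_commute)
      then show ?thesis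
        by (simp add: \<delta>_def power2_eq_square divide_inverse)
    qed
    finally have nH: "(norm H)\<^sup>2 = (norm G)\<^sup>2 - e / D"
      using D by (simp add: power2_eq_square)
    have "(\<Sum>k<N. p k * (norm (G *v v k))\<^sup>2) \<le> (\<Sum>k<N. p k * (2 / D))"
      unfolding D_def using p(1) Gv by (intro sum_mono mult_left_mono) auto
    then have "(\<Sum>k<N. p k * (norm (G *v v k))\<^sup>2) \<le> 2 / D"
      using p(2) by (simp flip: sum_distrib_right sum_divide_distrib)
    moreover have "(\<Sum>k<N. p k * (norm (G *v v k))\<^sup>2) = (\<Sum>k<N. \<Sum>i\<in>UNIV. p k * (G $ i \<bullet> v k)\<^sup>2)"
      unfolding power2_norm_eq_inner inner_vec_def[of "G *v _"] Gi
      by (simp add: sum_distrib_left power2_eq_square)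
    moreover have "\<dots> = (\<Sum>i\<in>UNIV. \<Sum>k<N. p k * (G $ i \<bullet> v k)\<^sup>2)"
      by (rule sum.swap)
    \<comment> \<open>The moment identity is applied to each row of \<open>G\<close>; the inner
      product of a row with \<open>u\<close> is a coordinate of \<open>G *v u\<close>.\<close>
    moreover have "\<dots> = (\<Sum>i\<in>UNIV. ((G *v u) $ i * (G *v u) $ i) / D\<^sup>2 + \<beta> * ((norm (G $ i))\<^sup>2 - ((G *v u) $ i * (G *v u) $ i) / D))"
      unfolding mom by (intro sum.cong refl) (simp add: Gi[of _ u] D_def power_divide power2_norm_eq_inner, simp add: power2_eq_square)
    moreover have "\<dots> = (e + D) / D\<^sup>2 + \<beta> * ((norm G)\<^sup>2 - (e + D) / D)"
      unfolding GuGu[symmetric] inner_vec_def[of "G *v u"] norm_matrix_rows[of G]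
      by (simp add: sum.distrib sum_divide_distrib sum_subtractf flip: sum_distrib_left)
    ultimately have le: "(e + D) / D\<^sup>2 + \<beta> * ((norm G)\<^sup>2 - (e + D) / D) \<le> 2 / D"
      by simp
    have s: "(e + D) / D\<^sup>2 = e / D\<^sup>2 + 1 / D" "(e + D) / D = e / D + 1"
      using D by (simp_all add: add_divide_distrib power2_eq_square)
    have nH1: "(norm H)\<^sup>2 - 1 = (norm G)\<^sup>2 - (e / D + 1)" and two: "2 / D = 1 / D + 1 / D"
      using nH by simp_all
    have "e / D\<^sup>2 + 1 / D + \<beta> * ((norm H)\<^sup>2 - 1) \<le> 1 / D + 1 / D"
      using le unfolding s nH1 two .
    then have "e / D\<^sup>2 + \<beta> * ((norm H)\<^sup>2 - 1) \<le> \<beta> * (real CARD('m) - 1)"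
      unfolding m by linarith
    \<comment> \<open>Besides the norm bound this keeps the slack e/D^2. If the norm of
      \<open>H\<close> is maximal, then \<open>e = 0\<close>, the shear is trivial and
      \<open>G\<close> itself is orthogonal.\<close>
    then have key: "e / D\<^sup>2 \<le> \<beta> * (real CARD('m) - (norm H)\<^sup>2)"
      by (simp add: algebra_simps)
    moreover have "0 \<le> e / D\<^sup>2"
      by (simp add: e_def)
    ultimately have "0 \<le> \<beta> * (real CARD('m) - (norm H)\<^sup>2)"
      by linarith
    then have nle: "(norm H)\<^sup>2 \<le> CARD('m)"
      using \<beta>(1) by (simp add: zero_le_mult_iff)
    have "G \<in> symmetry_group u" if "\<bar>det G\<bar> = 1"
    proof -
      have oH: "orthogonal_matrix H"
        using det_le_1(2)[OF nle] that detH by simp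
      then have "norm (H $ i) = 1" for i
        by (auto simp: orthogonal_matrix_orthonormal_rows row_def)
      then have "(norm H)\<^sup>2 = CARD('m)"
        by (simp add: norm_matrix_rows)
      then have "e \<le> 0"
        using key D by (simp add: divide_le_0_iff)
      then have Gu: "G *v u = u"
        by (simp add: e_def)
      then have "H $ i = G $ i" for i
        by (simp add: Hrow \<delta>_def)
      then have "H = G"
        by (simp add: vec_eq_iff)
      then show ?thesis
        using oH Gu by (simp add: symmetry_group_def)
    qed
    then show ?thesis
      using det_le_1(1)[OF nle] detH by simp
  qed
  then show "\<bar>det G\<bar> \<le> 1" "\<bar>det G\<bar> = 1 \<Longrightarrow> G \<in> symmetry_group u"
    by auto
qed

subsection \<open>Volume of images of the ball\<close>

lemma mem_spherical_space:
  assumes "u \<noteq> 0"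
  shows "v \<in> spherical_space u \<longleftrightarrow> u \<bullet> v = 1 \<and> (norm v)\<^sup>2 \<le> 2 / (u \<bullet> u)"
proof -
  have "norm v \<le> sqrt 2 / norm u \<longleftrightarrow> (norm v)\<^sup>2 \<le> 2 / (u \<bullet> u)"
    using real_sqrt_le_iff[of "(norm v)\<^sup>2" "2 / (u \<bullet> u)"]
    by (simp add: real_sqrt_divide norm_eq_sqrt_inner[of u])
  then show ?thesis
    using assms by (auto simp: spherical_space_def cone_fun_def divide_inverse)
qed

lemma center_in_spherical_space:
  assumes "u \<noteq> 0"
  shows "u /\<^sub>R (u \<bullet> u) \<in> spherical_space u"
  using assms by (simp add: mem_spherical_space power_divide power_mult_distrib power2_norm_eq_inner)
    (simp add: divide_inverse power2_eq_square)

lemma compact_spherical_space: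
  assumes "u \<noteq> 0"
  shows "compact (spherical_space u)"
proof -
  have "closed (spherical_space u)"
    unfolding spherical_space_def cone_fun_def
    by (intro closed_Collect_conj closed_Collect_le closed_Collect_eq continuous_intros)
  moreover have "bounded (spherical_space u)"
  proof (rule boundedI)
    show "norm v \<le> sqrt (2 / (u \<bullet> u))" if "v \<in> spherical_space u" for v
      using that assms by (intro real_le_rsqrt) (simp add: mem_spherical_space)
  qed
  ultimately show ?thesis
    by (simp add: compact_eq_bounded_closed)
qed

lemma norm_add_perp_center:
  assumes "u \<noteq> 0" "u \<bullet> w = 0"
  shows "(norm (u /\<^sub>R (u \<bullet> u) + w))\<^sup>2 = 1 / (u \<bullet> u) + (norm w)\<^sup>2"
  using assms by (simp add: power2_norm_eq_inner inner_add_left inner_add_right inner_commute[of w u] divide_inverse)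

lemma affine_hull_spherical_space:
  assumes u: "u \<noteq> 0"
  shows "affine hull (spherical_space u) = {x. u \<bullet> x = 1}"
proof
  show "affine hull (spherical_space u) \<subseteq> {x. u \<bullet> x = 1}"
    by (rule hull_minimal) (auto simp: spherical_space_def affine_hyperplane)
  show "{x. u \<bullet> x = 1} \<subseteq> affine hull (spherical_space u)"
  proof
    fix x assume "x \<in> {x. u \<bullet> x = 1}"
    then have x: "u \<bullet> x = 1" by simp
    define c where "c = u /\<^sub>R (u \<bullet> u)"
    define w where "w = x - c"
    \<comment> \<open>Shrinks \<open>w\<close> to length at most 1/|u|, the radius of the ball about
      its centre; the summand 1 keeps the denominator positive when \<open>w = 0\<close>. The line
      from the centre through the shrunken point then reaches \<open>x\<close>.\<close>
    define t where "t = 1 / (1 + norm w * norm u)"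
    have t: "t > 0"
      by (simp add: t_def add_pos_nonneg)
    have uw: "u \<bullet> w = 0" "u \<bullet> c = 1"
      using u x by (simp_all add: w_def c_def inner_diff_right)
    have "norm (t *\<^sub>R w) * norm u \<le> 1"
      using t by (simp add: t_def divide_le_eq add_pos_nonneg)
    then have "(norm (t *\<^sub>R w) * norm u)\<^sup>2 \<le> 1"
      by (simp add: power_le_one)
    then have "(norm (t *\<^sub>R w))\<^sup>2 \<le> 1 / (u \<bullet> u)"
      using u by (simp add: power_mult_distrib power2_norm_eq_inner[of u] pos_le_divide_eq)
    then have "c + t *\<^sub>R w \<in> spherical_space u"
      using u uw norm_add_perp_center[of u "t *\<^sub>R w"]
      by (simp add: mem_spherical_space c_def[symmetric] inner_add_right)
    then have 1: "c + t *\<^sub>R w \<in> affine hull (spherical_space u)"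
      by (rule hull_inc)
    have 2: "c \<in> affine hull (spherical_space u)"
      using center_in_spherical_space[OF u] by (simp add: c_def hull_inc)
    have "(1 - 1 / t) *\<^sub>R c + (1 / t) *\<^sub>R (c + t *\<^sub>R w) \<in> affine hull (spherical_space u)"
      by (rule mem_affine[OF affine_affine_hull 2 1]) simp
    also have "(1 - 1 / t) *\<^sub>R c + (1 / t) *\<^sub>R (c + t *\<^sub>R w) = x"
      using t by (simp add: scaleR_add_right scaleR_diff_left w_def)
    finally show "x \<in> affine hull (spherical_space u)" .
  qed
qed

lemma span_hyperplane:
  assumes u: "u \<noteq> 0" and S: "{x. u \<bullet> x = 1} \<subseteq> span S"
  shows "span S = UNIV"
proof -
  define c where "c = u /\<^sub>R (u \<bullet> u)"
  have c: "u \<bullet> c = 1"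
    using u by (simp add: c_def)
  then have cS: "c \<in> span S"
    using S by auto
  have "x \<in> span S" for x
  proof -
    have "u \<bullet> (x + (1 - u \<bullet> x) *\<^sub>R c) = 1"
      using c by (simp add: inner_add_right)
    then have "x + (1 - u \<bullet> x) *\<^sub>R c \<in> span S"
      using S by auto
    then have "(x + (1 - u \<bullet> x) *\<^sub>R c) - (1 - u \<bullet> x) *\<^sub>R c \<in> span S"
      using cS by (intro span_diff span_scale)
    then show ?thesis by simp
  qed
  then show ?thesis by blast
qed

lemma span_spherical_space: "u \<noteq> 0 \<Longrightarrow> span (spherical_space u) = UNIV"
  using span_hyperplane[of u "spherical_space u"] affine_hull_subset_span[of "spherical_space u"]
  by (simp add: affine_hull_spherical_space)

text \<open>A prism over a subset of the hyperplane, with edges along the normal \<open>u\<close>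
  and hence of height |u|. It has full dimension, so Lebesgue measure and determinants apply to
  it.\<close>

definition cylinder :: "'a::euclidean_space \<Rightarrow> 'a set \<Rightarrow> 'a set" where
  "cylinder u E = {v + s *\<^sub>R u |v s. v \<in> E \<and> s \<in> {0..1}}"

lemma compact_cylinder: "compact E \<Longrightarrow> compact (cylinder u E)"
proof -
  assume E: "compact E"
  have "cylinder u E = (\<lambda>x. fst x + snd x *\<^sub>R u) ` (E \<times> {0..1})"
    by (force simp: cylinder_def)
  then show ?thesis
    using E by (auto intro!: compact_continuous_image compact_Times continuous_intros)
qed

lemma measurable_pair_PiM_vec:
  fixes \<iota> :: "'b \<Rightarrow> 'm::finite"
  assumes \<iota>: "bij_betw \<iota> B (UNIV - {z})"
  shows "(\<lambda>(f, s). \<chi> i. if i = z then s else f (inv_into B \<iota> i)) \<in>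
    borel_measurable (Pi\<^sub>M B (\<lambda>_. lborel :: real measure) \<Otimes>\<^sub>M lborel)" (is "?T \<in> borel_measurable (?P \<Otimes>\<^sub>M _)")
proof (rule borel_measurable_euclidean_space[THEN iffD2], rule ballI)
    have inB: "inv_into B \<iota> i \<in> B" if "i \<noteq> z" for i
    using that \<iota> by (auto simp: bij_betw_def inv_into_into)
  fix b :: "real^'m" assume "b \<in> Basis"
  then obtain i where b: "b = axis i 1" by (auto simp: Basis_vec_def)
  show "(\<lambda>x. ?T x \<bullet> b) \<in> borel_measurable (?P \<Otimes>\<^sub>M lborel)"
  proof (cases "i = z")
    case True
    then show ?thesis
      by (simp add: b inner_axis case_prod_beta)
  next
    case False
    have "(\<lambda>x. fst x (inv_into B \<iota> i)) \<in> borel_measurable (?P \<Otimes>\<^sub>M lborel)"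
      using inB[OF False] by measurable
    then show ?thesis
      using False by (simp add: b inner_axis case_prod_beta)
  qed
qed

text \<open>Separates one coordinate, to be used as the height of a prism, and indexes the others by
  \<open>B\<close>, which will be an orthonormal basis of the direction space. Agreement on boxes
  suffices.\<close>

lemma lborel_eq_distr_pair_PiM:
  fixes \<iota> :: "'b \<Rightarrow> 'm::finite"
  assumes B: "finite B" and \<iota>: "bij_betw \<iota> B (UNIV - {z})"
  shows "(lborel :: (real^'m) measure) = distr (Pi\<^sub>M B (\<lambda>_. lborel) \<Otimes>\<^sub>M lborel) borel
    (\<lambda>(f, s). \<chi> i. if i = z then s else f (inv_into B \<iota> i))"
proof (rule lborel_eqI)
  interpret finite_product_sigma_finite "\<lambda>_. lborel :: real measure" B
    by unfold_locales (use B sigma_finite_lborel in auto)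
  let ?P = "Pi\<^sub>M B (\<lambda>_. lborel :: real measure)"
  let ?T = "\<lambda>(f, s). \<chi> i. if i = z then s else (f (inv_into B \<iota> i) :: real)"
  have inB: "inv_into B \<iota> i \<in> B" "\<iota> (inv_into B \<iota> i) = i" if "i \<noteq> z" for i
    using that \<iota> by (auto simp: bij_betw_def inv_into_into f_inv_into_f)
  have \<iota>B: "\<iota> b \<noteq> z" "inv_into B \<iota> (\<iota> b) = b" if "b \<in> B" for b
    using that \<iota> by (auto simp: bij_betw_def)
  have T: "?T \<in> borel_measurable (?P \<Otimes>\<^sub>M lborel)"
    by (rule measurable_pair_PiM_vec[OF \<iota>])
  fix l u :: "real^'m" assume le: "\<And>b. b \<in> Basis \<Longrightarrow> l \<bullet> b \<le> u \<bullet> b"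
  have lei: "l $ i \<le> u $ i" for i
    using le[of "axis i 1"] by (simp add: inner_axis)
  have "?T -` box l u \<inter> space (?P \<Otimes>\<^sub>M lborel) = (Pi\<^sub>E B (\<lambda>b. {l $ \<iota> b <..< u $ \<iota> b})) \<times> {l $ z <..< u $ z}"
    (is "?L = ?R")
  proof (intro set_eqI iffI)
    fix x assume x: "x \<in> ?L"
    obtain f s where fs: "x = (f, s)" by (cases x)
    have f: "f \<in> extensional B"
      using x by (simp add: fs space_pair_measure space_PiM PiE_def)
    have lt: "l $ i < (if i = z then s else f (inv_into B \<iota> i)) \<and> (if i = z then s else f (inv_into B \<iota> i)) < u $ i" for i
      using x by (auto simp: fs mem_box_cart)
    have "f b \<in> {l $ \<iota> b <..< u $ \<iota> b}" if "b \<in> B" for b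
      using lt[of "\<iota> b"] \<iota>B[OF that] by simp
    moreover have "s \<in> {l $ z <..< u $ z}"
      using lt[of z] by simp
    ultimately show "x \<in> ?R"
      using f by (simp add: fs PiE_def)
  next
    fix x assume x: "x \<in> ?R"
    obtain f s where fs: "x = (f, s)" by (cases x)
    have "l $ i < (if i = z then s else f (inv_into B \<iota> i)) \<and> (if i = z then s else f (inv_into B \<iota> i)) < u $ i" for i
    proof (cases "i = z")
      case False
      then have "f (inv_into B \<iota> i) \<in> {l $ \<iota> (inv_into B \<iota> i) <..< u $ \<iota> (inv_into B \<iota> i)}"
        using x inB(1)[OF False] unfolding fs by (blast dest: PiE_mem)
      then show ?thesis
        using False inB(2)[OF False] by simp
    qed (use x fs in auto)
    moreover have "f \<in> extensional B"
      using x by (simp add: fs PiE_def)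
    ultimately show "x \<in> ?L"
      by (simp add: fs mem_box_cart space_pair_measure space_PiM PiE_def)
  qed
  then have "emeasure (distr (?P \<Otimes>\<^sub>M lborel) borel ?T) (box l u) = emeasure (?P \<Otimes>\<^sub>M lborel) ?R"
    using T by (simp add: emeasure_distr)
  also have "\<dots> = (\<Prod>b\<in>B. ennreal (u $ \<iota> b - l $ \<iota> b)) * ennreal (u $ z - l $ z)"
    using lei B by (subst lborel.emeasure_pair_measure_Times) (auto simp: measure_times)
  also have "\<dots> = ennreal ((\<Prod>b\<in>B. u $ \<iota> b - l $ \<iota> b) * (u $ z - l $ z))"
    using lei by (simp add: prod_ennreal ennreal_mult prod_nonneg)
  also have "(\<Prod>b\<in>B. u $ \<iota> b - l $ \<iota> b) = (\<Prod>i\<in>UNIV - {z}. u $ i - l $ i)"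
    by (rule prod.reindex_bij_betw[OF \<iota>])
  also have "\<dots> * (u $ z - l $ z) = (\<Prod>i\<in>UNIV. u $ i - l $ i)"
    by (subst prod.remove[of UNIV z]) (auto simp: mult.commute)
  also have "\<dots> = (\<Prod>b\<in>Basis. (u - l) \<bullet> b)"
    by (rule prod.reindex_cong[of "\<lambda>i. axis i 1", symmetric])
       (auto simp: Basis_vec_def inj_on_def axis_eq_axis inner_axis)
  finally show "emeasure (distr (?P \<Otimes>\<^sub>M lborel) borel ?T) (box l u) = ennreal (\<Prod>b\<in>Basis. (u - l) \<bullet> b)" .
qed simp

lemma emeasure_lborel_translation_image:
  fixes S :: "'a::euclidean_space set"
  assumes "compact S"
  shows "emeasure lborel ((+) c ` S) = emeasure lborel S"
proof -
  have "(+) c ` S \<in> sets borel"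
    using compact_translation[OF assms] by (simp add: compact_imp_closed)
  then have "emeasure (distr lborel borel ((+) c)) ((+) c ` S) = emeasure lborel ((+) c -` (+) c ` S)"
    by (simp add: emeasure_distr)
  then show ?thesis
    by (simp add: lborel_distr_plus inj_vimage_image_eq)
qed

lemma orthonormal_frame_exists:
  assumes "subspace V"
  shows "\<exists>F. orthonormal_frame ((\<lambda>x. a + x) ` V) F"
proof -
  obtain B where "pairwise orthogonal B" "\<And>x. x \<in> B \<Longrightarrow> norm x = 1" "span B = V"
    using orthonormal_basis_subspace[OF assms] by metis
  then have "orthonormal_frame ((\<lambda>x. a + x) ` V) (a, B)"
    by (simp add: orthonormal_frame_def)
  then show ?thesis ..
qed

text \<open>Thickening by a unit of \<open>u\<close> turns the \<open>(m - 1)\<close>-dimensional volume of the image under \<open>N\<close>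
  into an \<open>m\<close>-dimensional Lebesgue measure, up to a factor that does not depend on the set.\<close>

lemma emeasure_cylinder_eq_vol:
  fixes N :: "real^'m^'n" and u :: "real^'m"
  assumes u: "u \<noteq> 0" and Nl: "Nl ** N = mat 1"
  obtains \<kappa> :: real where "\<kappa> > 0"
    "\<And>E. \<lbrakk>compact E; affine hull E = {x. u \<bullet> x = 1}\<rbrakk> \<Longrightarrow>
      emeasure lborel (cylinder u E) = ennreal \<kappa> * vol ((*v) N ` E)"
proof -
  define A where "A = (*v) N ` {x. u \<bullet> x = 1}"
  define U where "U = {x. u \<bullet> x = 0}"
  have NlN: "Nl *v (N *v x) = x" for x
    by (simp add: matrix_vector_mul_assoc Nl)
  have inj: "inj ((*v) N)"
    by (metis NlN injI)
  have subU: "subspace U" "subspace ((*v) N ` U)"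
    by (auto simp: U_def subspace_hyperplane linear_subspace_image)
  have A_eq: "A = (\<lambda>x. N *v v + x) ` ((*v) N ` U)" if v: "u \<bullet> v = 1" for v
  proof -
    have "{x. u \<bullet> x = 1} = (\<lambda>x. v + x) ` U"
    proof (intro set_eqI iffI)
      fix x assume "x \<in> {x. u \<bullet> x = 1}"
      then have "x - v \<in> U"
        using v by (simp add: U_def inner_diff_right)
      then show "x \<in> (\<lambda>x. v + x) ` U"
        by (intro image_eqI[of _ _ "x - v"]) auto
    qed (use v in \<open>auto simp: U_def inner_add_right\<close>)
    then show ?thesis
      by (simp add: A_def image_image matrix_vector_right_distrib)
  qed
  have "u \<bullet> (u /\<^sub>R (u \<bullet> u)) = 1"
    using u by simp
  from A_eq[OF this] have "\<exists>F. orthonormal_frame A F"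
    using orthonormal_frame_exists[OF subU(2)] by simp
  then have frame_SOME: "orthonormal_frame A (SOME F. orthonormal_frame A F)"
    by (rule someI_ex)
  \<comment> \<open>This is the very frame selected inside \<open>affine_lebesgue\<close>, so its
    distribution can be matched literally at the end.\<close>
  obtain a B where aB: "(SOME F. orthonormal_frame A F) = (a, B)"
    by (cases "SOME F. orthonormal_frame A F")
  have orthB: "pairwise orthogonal B" and normB: "\<And>b. b \<in> B \<Longrightarrow> norm b = 1"
    and aspan: "(\<lambda>x. a + x) ` span B = A"
    using frame_SOME unfolding aB by (auto simp: orthonormal_frame_def)
  have indep: "independent B"
    using orthB normB by (intro pairwise_orthogonal_independent) force+
  then have finB: "finite B"
    by (rule independent_imp_finite)
  have "a + 0 \<in> A"
    unfolding aspan[symmetric] by (intro imageI span_zero)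
  then obtain v0 where v0: "u \<bullet> v0 = 1" "a = N *v v0"
    by (auto simp: A_def)
  have "(\<lambda>x. a + x) ` span B = (\<lambda>x. a + x) ` ((*v) N ` U)"
    using aspan A_eq[OF v0(1)] v0(2) by simp
  then have spanB: "span B = (*v) N ` U"
    by (simp add: inj_image_eq_iff)
  have "card B = dim ((*v) N ` U)"
    using indep spanB dim_span_eq_card_independent by metis
  also have "\<dots> = dim U"
    using inj by (intro dim_image_eq) (auto intro: inj_on_subset)
  also have "\<dots> = CARD('m) - 1"
    using dim_hyperplane[OF u] by (simp add: U_def)
  finally have cardB: "card B = CARD('m) - 1" .
  \<comment> \<open>An arbitrary index, reserved for the height; the remaining m - 1 coordinates
    correspond to the basis \<open>B\<close>.\<close>
  define z :: 'm where "z = undefined"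
  have "card B = card (UNIV - {z})"
    by (simp add: cardB card_Diff_singleton)
  from finite_same_card_bij[OF finB _ this] obtain \<iota> where \<iota>: "bij_betw \<iota> B (UNIV - {z})"
    by auto
  have inB: "inv_into B \<iota> i \<in> B" "\<iota> (inv_into B \<iota> i) = i" if "i \<noteq> z" for i
    using that \<iota> by (auto simp: bij_betw_def inv_into_into f_inv_into_f)
  have \<iota>B: "\<iota> b \<noteq> z" "inv_into B \<iota> (\<iota> b) = b" if "b \<in> B" for b
    using that \<iota> by (auto simp: bij_betw_def)
  define w where "w x = (\<Sum>b\<in>B. x $ \<iota> b *\<^sub>R b)" for x :: "real^'m"
  have w_span: "w x \<in> span B" for x
    unfolding w_def by (intro span_sum span_scale span_base)
  have w_lin: "linear w"
    unfolding w_def by (rule linearI) (simp_all add: scaleR_add_left sum.distrib scaleR_sum_right)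
  \<comment> \<open>Turns frame coordinates and height into a point of the prism, up to the
    translation by \<open>Nl *v a\<close>. It is built from the frame, \<open>Nl\<close> and
    \<open>u\<close> alone, which is why \<kappa> does not depend on \<open>E\<close>.\<close>
  define \<Lambda> where "\<Lambda> x = Nl *v w x + x $ z *\<^sub>R u" for x
  have \<Lambda>_lin: "linear \<Lambda>"
    unfolding \<Lambda>_def
    by (rule linearI) (simp_all add: linear_add[OF w_lin] linear_scale[OF w_lin] matrix_vector_right_distrib
        matrix_vector_mult_scaleR scaleR_add_left scaleR_add_right)
  have w_inner: "w x \<bullet> b = x $ \<iota> b" if "b \<in> B" for x b
  proof -
    have "w x \<bullet> b = (\<Sum>c\<in>B. if c = b then x $ \<iota> b else 0)"
      unfolding w_def inner_sum_left using that orthB normB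
      by (intro sum.cong) (auto simp: pairwise_def orthogonal_def norm_eq_1)
    then show ?thesis
      using that finB by simp
  qed
  have "inj \<Lambda>"
    unfolding linear_injective_0[OF \<Lambda>_lin]
  proof (intro allI impI)
    fix x assume 0: "\<Lambda> x = 0"
    obtain y where y: "w x = N *v y" "u \<bullet> y = 0"
      using w_span[of x] by (auto simp: spanB U_def)
    then have "y + x $ z *\<^sub>R u = 0"
      using 0 by (simp add: \<Lambda>_def NlN)
    moreover from arg_cong[OF this, of "\<lambda>v. u \<bullet> v"] have xz: "x $ z = 0"
      using u y(2) by (simp add: inner_add_right)
    ultimately have "y = 0"
      by simp
    then have "w x = 0"
      using y by simp
    then have "x $ i = 0" if "i \<noteq> z" for i
      using w_inner[OF inB(1)[OF that], of x] inB(2)[OF that] by simp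
    with xz show "x = 0"
      by (metis vec_eq_iff zero_index)
  qed
  then have det: "det (matrix \<Lambda>) \<noteq> 0"
    using det_nz_iff_inj[OF \<Lambda>_lin] by blast
  define \<kappa> where "\<kappa> = \<bar>det (matrix \<Lambda>)\<bar>"
  have \<Lambda>_cont: "continuous_on S \<Lambda>" and w_cont: "continuous_on S w" for S
    using \<Lambda>_lin w_lin by (simp_all add: linear_continuous_on linear_conv_bounded_linear)
  have main: "emeasure lborel (cylinder u E) = ennreal \<kappa> * vol ((*v) N ` E)"
    if E: "compact E" "affine hull E = {x. u \<bullet> x = 1}" for E
  proof -
    have cE: "compact ((*v) N ` E)"
      using E by (intro compact_continuous_image linear_continuous_on) auto
    \<comment> \<open>The prism in coordinates: a product of the frame coordinates of the image of
      \<open>E\<close> with the unit interval. Its Lebesgue measure is therefore the volume of that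
      image times 1.\<close>
    define D where "D = {x. a + w x \<in> (*v) N ` E \<and> x $ z \<in> {0..1}}"
    have "D = (\<lambda>x. a + w x) -` ((*v) N ` E) \<inter> {x. 0 \<le> x $ z} \<inter> {x. x $ z \<le> 1}"
      by (auto simp: D_def)
    then have "closed D"
      using cE w_cont
      by (auto intro!: closed_Int closed_vimage closed_Collect_le continuous_intros simp: compact_imp_closed)
    have E_A: "(*v) N ` E \<subseteq> A"
      using E(2) hull_subset[of E affine] by (auto simp: A_def)
    have cyl: "cylinder u E = (+) (Nl *v a) ` (\<Lambda> ` D)"
    proof (intro set_eqI iffI)
      fix y assume "y \<in> cylinder u E"
      then obtain e s where es: "y = e + s *\<^sub>R u" "e \<in> E" "s \<in> {0..1}"
        by (auto simp: cylinder_def)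
      have "N *v e \<in> (\<lambda>x. a + x) ` span B"
        using E_A es(2) by (auto simp: aspan)
      then obtain t where t: "t \<in> span B" "N *v e = a + t" by auto
      define x where "x = (\<chi> i. if i = z then s else t \<bullet> inv_into B \<iota> i)"
      have "w x = (\<Sum>b\<in>B. (t \<bullet> b) *\<^sub>R b)"
        unfolding w_def by (intro sum.cong) (auto simp: x_def \<iota>B)
      also have "\<dots> = t"
        by (rule orthonormal_basis_expand[OF orthB normB t(1) finB])
      finally have wx: "w x = t" .
      have xz: "x $ z = s" by (simp add: x_def)
      have "a + w x \<in> (*v) N ` E"
        unfolding wx t(2)[symmetric] using es(2) by (rule imageI)
      then have "x \<in> D"
        using es(3) by (simp add: D_def xz)
      moreover have "y = Nl *v a + \<Lambda> x"
        using es t NlN[of e] by (simp add: \<Lambda>_def wx xz matrix_vector_right_distrib)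
      ultimately show "y \<in> (+) (Nl *v a) ` (\<Lambda> ` D)"
        by blast
    next
      fix y assume "y \<in> (+) (Nl *v a) ` (\<Lambda> ` D)"
      then obtain x where x: "x \<in> D" "y = Nl *v a + \<Lambda> x" by auto
      then obtain e where e: "e \<in> E" "a + w x = N *v e" by (auto simp: D_def)
      have "y = e + x $ z *\<^sub>R u"
        using NlN[of e] unfolding e(2)[symmetric]
        by (simp add: x \<Lambda>_def matrix_vector_right_distrib)
      then show "y \<in> cylinder u E"
        using x e by (auto simp: cylinder_def D_def)
    qed
    have "compact (\<Lambda> ` D)"
    proof -
      have "\<Lambda> ` D = (+) (- (Nl *v a)) ` cylinder u E"
        unfolding cyl by (simp add: image_image)
      then show ?thesis
        using compact_translation[OF compact_cylinder[OF E(1)]] by metis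
    qed
    then have "emeasure lborel (cylinder u E) = emeasure lborel (\<Lambda> ` D)"
      unfolding cyl by (rule emeasure_lborel_translation_image)
    also have "\<Lambda> ` D = (*v) (matrix \<Lambda>) ` D"
      by (simp only: matrix_vector_mul(2)[OF \<Lambda>_lin])
    also have "emeasure lborel \<dots> = ennreal \<kappa> * emeasure lborel D"
      unfolding \<kappa>_def using \<open>closed D\<close> by (intro emeasure_lborel_matrix_image det) auto
    also have "emeasure lborel D = vol ((*v) N ` E)"
    proof -
      interpret finite_product_sigma_finite "\<lambda>_. lborel :: real measure" B
        by unfold_locales (use finB sigma_finite_lborel in auto)
      let ?P = "Pi\<^sub>M B (\<lambda>_. lborel :: real measure)"
      let ?T = "\<lambda>(f, s). \<chi> i. if i = z then s else (f (inv_into B \<iota> i) :: real)"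
      let ?\<phi> = "\<lambda>f. a + (\<Sum>b\<in>B. f b *\<^sub>R b)"
      let ?Q = "?\<phi> -` ((*v) N ` E) \<inter> space ?P"
      have \<phi>: "?\<phi> \<in> borel_measurable ?P"
        by (intro borel_measurable_add borel_measurable_sum borel_measurable_scaleR borel_measurable_const)
          (simp add: measurable_component_singleton)
      have NE: "(*v) N ` E \<in> sets borel"
        using cE by (simp add: compact_imp_closed)
      have Q: "?Q \<in> sets ?P"
        by (rule measurable_sets[OF \<phi> NE])
      have T: "?T \<in> borel_measurable (?P \<Otimes>\<^sub>M lborel)"
        by (rule measurable_pair_PiM_vec[OF \<iota>])
      have wT: "w (?T (f, s)) = (\<Sum>b\<in>B. f b *\<^sub>R b)" for f s
        unfolding w_def by (intro sum.cong) (auto simp: \<iota>B)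
      have "emeasure lborel D = emeasure (?P \<Otimes>\<^sub>M lborel) (?T -` D \<inter> space (?P \<Otimes>\<^sub>M lborel))"
        using \<open>closed D\<close> T by (subst lborel_eq_distr_pair_PiM[OF finB \<iota>]) (simp add: emeasure_distr)
      also have "?T -` D \<inter> space (?P \<Otimes>\<^sub>M lborel) = ?Q \<times> {0..1}"
        using wT by (auto simp: D_def space_pair_measure)
      also have "emeasure (?P \<Otimes>\<^sub>M lborel) \<dots> = emeasure ?P ?Q"
        using Q by (subst lborel.emeasure_pair_measure_Times) auto
      also have "\<dots> = emeasure (distr ?P borel ?\<phi>) ((*v) N ` E)"
        using \<phi> NE by (simp add: emeasure_distr)
      also have "\<dots> = emeasure (completion (distr ?P borel ?\<phi>)) ((*v) N ` E)"
        using NE by (simp add: emeasure_completion)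
      also have "\<dots> = vol ((*v) N ` E)"
      proof -
        have "affine hull ((*v) N ` E) = A"
          using affine_hull_linear_image[of "(*v) N" E] E(2) by (simp add: A_def)
        then show ?thesis
          by (simp add: vol_def affine_lebesgue_def aB)
      qed
      finally show ?thesis .
    qed
    finally show ?thesis .
  qed
  show thesis
    by (rule that[of \<kappa>]) (use det main in \<open>auto simp: \<kappa>_def\<close>)
qed

text \<open>The map \<open>H\<close> sends the prism over \<open>E\<close> to one with edges along
  \<open>H *v u\<close> instead of \<open>u\<close>. The shear \<open>S\<close> straightens the
  edges, but moves the hyperplane by \<delta>; a translation by - \<delta> corrects this.\<close>

lemma emeasure_cylinder_linear_image:
  fixes H :: "real^'m^'m"
  assumes u: "u \<noteq> 0" and det: "det H \<noteq> 0" and H: "\<And>x. u \<bullet> (H *v x) = u \<bullet> x"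
    and E: "compact E" "\<And>x. x \<in> E \<Longrightarrow> u \<bullet> x = 1"
  shows "emeasure lborel (cylinder u ((*v) H ` E)) = ennreal \<bar>det H\<bar> * emeasure lborel (cylinder u E)"
proof -
  define \<delta> where "\<delta> = (u - H *v u) /\<^sub>R (u \<bullet> u)"
  define S where "S = (\<chi> i j. (if i = j then 1 else 0) + \<delta> $ i * u $ j :: real^'m^'m)"
  have "u \<bullet> \<delta> = 0"
    by (simp add: \<delta>_def inner_diff_right H)
  then have detS: "\<bar>det S\<bar> = 1"
    unfolding S_def by (rule abs_det_shear)
  have S: "S *v x = x + (u \<bullet> x) *\<^sub>R \<delta>" for x
    using rank_one_update_mult[of 1 \<delta> u x] by (simp add: S_def)
  have D\<delta>: "(u \<bullet> u) *\<^sub>R \<delta> = u - H *v u"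
    using u by (simp add: \<delta>_def)
  have eq: "H *v e + s *\<^sub>R u = - \<delta> + (S ** H) *v (e + s *\<^sub>R u)" if "u \<bullet> e = 1" for e s
  proof -
    have "(S ** H) *v (e + s *\<^sub>R u) = H *v e + s *\<^sub>R (H *v u) + (1 + s * (u \<bullet> u)) *\<^sub>R \<delta>"
      using that by (simp add: S H inner_add_right matrix_vector_right_distrib matrix_vector_mult_scaleR
          scaleR_add_left scaleR_add_right flip: matrix_vector_mul_assoc)
    also have "(1 + s * (u \<bullet> u)) *\<^sub>R \<delta> = \<delta> + s *\<^sub>R (u - H *v u)"
      by (simp add: scaleR_add_left D\<delta>[symmetric])
    finally show ?thesis
      by (simp add: scaleR_diff_right)
  qed
  have "cylinder u ((*v) H ` E) = (+) (- \<delta>) ` ((*v) (S ** H) ` cylinder u E)"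
  proof (intro set_eqI iffI)
    fix y assume "y \<in> cylinder u ((*v) H ` E)"
    then obtain e s where es: "e \<in> E" "s \<in> {0..1}" "y = H *v e + s *\<^sub>R u"
      by (auto simp: cylinder_def)
    then have "y = - \<delta> + (S ** H) *v (e + s *\<^sub>R u)"
      using eq[OF E(2)] by simp
    moreover have "e + s *\<^sub>R u \<in> cylinder u E"
      using es by (auto simp: cylinder_def)
    ultimately show "y \<in> (+) (- \<delta>) ` ((*v) (S ** H) ` cylinder u E)"
      by blast
  next
    fix y assume "y \<in> (+) (- \<delta>) ` ((*v) (S ** H) ` cylinder u E)"
    then obtain e s where es: "e \<in> E" "s \<in> {0..1}" "y = - \<delta> + (S ** H) *v (e + s *\<^sub>R u)"
      by (auto simp: cylinder_def)
    then have "y = H *v e + s *\<^sub>R u"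
      using eq[OF E(2)] by simp
    then show "y \<in> cylinder u ((*v) H ` E)"
      using es by (auto simp: cylinder_def)
  qed
  moreover have "compact ((*v) (S ** H) ` cylinder u E)"
    using compact_cylinder[OF E(1)] by (intro compact_continuous_image linear_continuous_on) auto
  ultimately have "emeasure lborel (cylinder u ((*v) H ` E)) = emeasure lborel ((*v) (S ** H) ` cylinder u E)"
    by (simp only: emeasure_lborel_translation_image)
  also have "\<dots> = ennreal \<bar>det (S ** H)\<bar> * emeasure lborel (cylinder u E)"
    using det detS compact_cylinder[OF E(1), of u]
    by (intro emeasure_lborel_matrix_image) (auto simp: det_mul compact_imp_closed)
  finally show ?thesis
    by (simp add: det_mul abs_mult detS)
qed

lemma cylinder_spherical_space_pos:
  assumes u: "u \<noteq> 0"
  shows "emeasure lborel (cylinder u (spherical_space u)) \<noteq> 0"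
proof -
  \<comment> \<open>Around the midpoint \<open>q\<close> of the axis, |u|/2 bounds the deviation in
    height and 1/|u|, the radius of the ball, bounds the orthogonal deviation.\<close>
  define \<epsilon> where "\<epsilon> = min (norm u / 2) (1 / norm u)"
  have \<epsilon>: "\<epsilon> > 0" "\<epsilon> \<le> norm u / 2" "\<epsilon> \<le> 1 / norm u"
    using u by (auto simp: \<epsilon>_def)
  have uu: "u \<bullet> u = norm u * norm u" "0 < norm u"
    using u by (auto simp: power2_norm_eq_inner[symmetric] power2_eq_square)
  define c where "c = u /\<^sub>R (u \<bullet> u)"
  define q where "q = c + (1 / 2) *\<^sub>R u"
  have "ball q \<epsilon> \<subseteq> cylinder u (spherical_space u)"
  proof
    fix x assume "x \<in> ball q \<epsilon>"
    then have x: "norm (x - q) < \<epsilon>"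
      by (simp add: dist_norm norm_minus_commute)
    define t where "t = (u \<bullet> (x - q)) / (u \<bullet> u)"
    define w where "w = (x - q) - t *\<^sub>R u"
    have uw: "u \<bullet> w = 0"
      using u by (simp add: w_def t_def inner_diff_right)
    have "\<bar>u \<bullet> (x - q)\<bar> \<le> norm u * norm (x - q)"
      by (rule Cauchy_Schwarz_ineq2)
    also have "\<dots> \<le> norm u * (norm u / 2)"
      using x \<epsilon> by (intro mult_left_mono) auto
    finally have "\<bar>t\<bar> \<le> 1 / 2"
      using uu by (simp add: t_def abs_divide divide_le_eq)
    then have s: "1 / 2 + t \<in> {0..1}"
      by auto
    have "(norm (x - q))\<^sup>2 = (norm w)\<^sup>2 + (norm (t *\<^sub>R u))\<^sup>2"
      using norm_add_Pythagorean[of w "t *\<^sub>R u"] uw by (simp add: w_def orthogonal_def inner_commute)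
    then have "(norm w)\<^sup>2 \<le> (norm (x - q))\<^sup>2"
      by simp
    also have "\<dots> \<le> (1 / norm u)\<^sup>2"
      using x \<epsilon> by (intro power_mono) auto
    finally have "(norm w)\<^sup>2 \<le> 1 / (u \<bullet> u)"
      by (simp add: uu power2_eq_square)
    then have "c + w \<in> spherical_space u"
      using u uw norm_add_perp_center[OF u uw] by (simp add: mem_spherical_space c_def[symmetric] inner_add_right)
        (simp add: c_def)
    moreover have "x = (c + w) + (1 / 2 + t) *\<^sub>R u"
      by (simp add: w_def q_def scaleR_add_left)
    ultimately show "x \<in> cylinder u (spherical_space u)"
      using s by (auto simp: cylinder_def)
  qed
  then have "emeasure lborel (ball q \<epsilon>) \<le> emeasure lborel (cylinder u (spherical_space u))"
    using compact_cylinder[OF compact_spherical_space[OF u], of u] by (intro emeasure_mono) (auto simp: compact_imp_closed)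
  moreover have "emeasure lborel (ball q \<epsilon>) \<noteq> 0"
    using open_not_negligible[of "ball q \<epsilon>"] \<epsilon> by (auto simp: negligible_iff_emeasure0)
  ultimately show ?thesis
    by auto
qed

text \<open>Both volumes are measured through prisms with the same factor \<kappa>, which is
  positive and finite and cancels. Positivity and finiteness of the volume make the later comparison
  of minimisers strict.\<close>

lemma vol_linear_image_spherical_space:
  fixes N :: "real^'m^'n" and H :: "real^'m^'m" and u :: "real^'m"
  assumes u: "u \<noteq> 0" and Nl: "Nl ** N = mat 1"
    and det: "det H \<noteq> 0" and H: "\<And>x. u \<bullet> (H *v x) = u \<bullet> x"
  defines "X \<equiv> spherical_space u"
  shows "vol ((*v) N ` (*v) H ` X) = ennreal \<bar>det H\<bar> * vol ((*v) N ` X)"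
    and "vol ((*v) N ` X) \<noteq> 0" and "vol ((*v) N ` X) \<noteq> \<infinity>"
proof -
  obtain \<kappa> :: real where \<kappa>: "\<kappa> > 0" and vol: "\<And>E. \<lbrakk>compact E; affine hull E = {x. u \<bullet> x = 1}\<rbrakk> \<Longrightarrow>
      emeasure lborel (cylinder u E) = ennreal \<kappa> * vol ((*v) N ` E)"
    using emeasure_cylinder_eq_vol[OF u Nl] by blast
  have X: "compact X" "affine hull X = {x. u \<bullet> x = 1}"
    using u by (simp_all add: X_def compact_spherical_space affine_hull_spherical_space)
  have X1: "\<And>x. x \<in> X \<Longrightarrow> u \<bullet> x = 1"
    by (simp add: X_def spherical_space_def)
  have HX: "compact ((*v) H ` X)"
    using X(1) by (intro compact_continuous_image linear_continuous_on) auto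
  have "surj ((*v) H)"
    using det by (metis invertible_det_nz invertible_eq_bij bij_is_surj)
  then have "(*v) H ` {x. u \<bullet> x = 1} = {x. u \<bullet> x = 1}"
    using H by (auto simp: image_iff) (metis surjD)
  then have aff: "affine hull ((*v) H ` X) = {x. u \<bullet> x = 1}"
    using affine_hull_linear_image[of "(*v) H" X] X(2) by simp
  have eX: "ennreal \<kappa> * vol ((*v) N ` X) = emeasure lborel (cylinder u X)"
    using vol[OF X(1,2)] by simp
  have "ennreal \<kappa> * vol ((*v) N ` (*v) H ` X) = ennreal \<bar>det H\<bar> * emeasure lborel (cylinder u X)"
    using vol[OF HX aff] emeasure_cylinder_linear_image[OF u det H X(1) X1] by simp
  then have "ennreal \<kappa> * vol ((*v) N ` (*v) H ` X) = ennreal \<kappa> * (ennreal \<bar>det H\<bar> * vol ((*v) N ` X))"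
    unfolding eX[symmetric] by (simp add: ac_simps)
  then show "vol ((*v) N ` (*v) H ` X) = ennreal \<bar>det H\<bar> * vol ((*v) N ` X)"
    using \<kappa> by (simp add: ennreal_mult_cancel_left)
  show "vol ((*v) N ` X) \<noteq> 0"
    using eX cylinder_spherical_space_pos[OF u] by (auto simp: X_def)
  show "vol ((*v) N ` X) \<noteq> \<infinity>"
    using eX emeasure_compact_finite[OF compact_cylinder[OF X(1), of u]] \<kappa> by (auto simp: ennreal_mult_top)
qed

subsection \<open>The pseudoinverse\<close>

lemma orthogonal_projection_matrix_exists:
  fixes V :: "(real^'n) set"
  assumes V: "subspace V"
  obtains P :: "real^'n^'n" where "transpose P = P" "\<And>x. P *v x \<in> V" "\<And>x. x \<in> V \<Longrightarrow> P *v x = x"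
proof -
  obtain B where B: "B \<subseteq> V" "pairwise orthogonal B" "\<And>x. x \<in> B \<Longrightarrow> norm x = 1"
      "independent B" "span B = V"
    using orthonormal_basis_subspace[OF V] by metis
  have fin: "finite B"
    using B(4) by (rule independent_imp_finite)
  define P :: "real^'n^'n" where "P = (\<chi> i j. \<Sum>b\<in>B. b $ i * b $ j)"
  have P: "P *v x = (\<Sum>b\<in>B. (x \<bullet> b) *\<^sub>R b)" for x
  proof -
    have "(P *v x) $ i = (\<Sum>b\<in>B. (x \<bullet> b) *\<^sub>R b) $ i" for i
    proof -
      have "(P *v x) $ i = (\<Sum>j\<in>UNIV. \<Sum>b\<in>B. x $ j * b $ j * b $ i)"
        unfolding P_def matrix_vector_mult_def by (simp add: sum_distrib_left sum_distrib_right mult_ac)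
      also have "\<dots> = (\<Sum>b\<in>B. \<Sum>j\<in>UNIV. x $ j * b $ j * b $ i)"
        by (rule sum.swap)
      finally show ?thesis
        by (simp add: inner_vec_def sum_distrib_right)
    qed
    then show ?thesis
      unfolding vec_eq_iff by blast
  qed
  show thesis
  proof (rule that)
    show "transpose P = P"
      by (simp add: P_def transpose_def mult.commute)
    show "P *v x \<in> V" for x
      unfolding P B(5)[symmetric] by (intro span_sum span_scale span_base)
    show "P *v x = x" if "x \<in> V" for x
      unfolding P using that B fin by (intro orthonormal_basis_expand) auto
  qed
qed

text \<open>Transposing the product of the symmetric matrices \<open>M ** Q\<close> and
  \<open>M ** P\<close> reverses it, and the two orders simplify to \<open>M ** P\<close> and
  \<open>M ** Q\<close>. The same argument on the other side gives
  \<open>P ** M = Q ** M\<close>.\<close>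

lemma pinv_unique:
  fixes M :: "real^'l^'n"
  assumes P: "M ** P ** M = M" "P ** M ** P = P" "transpose (M ** P) = M ** P" "transpose (P ** M) = P ** M"
    and Q: "M ** Q ** M = M" "Q ** M ** Q = Q" "transpose (M ** Q) = M ** Q" "transpose (Q ** M) = Q ** M"
  shows "P = Q"
proof -
  have "M ** P = transpose ((M ** Q) ** (M ** P))"
    using Q(1) P(3) by (simp add: matrix_mul_assoc)
  also have "\<dots> = (M ** P) ** (M ** Q)"
    using P(3) Q(3) by (simp add: matrix_transpose_mul[of "M ** Q"])
  also have "\<dots> = M ** Q"
    using P(1) by (simp add: matrix_mul_assoc)
  finally have 1: "M ** P = M ** Q" .
  have "P ** M = transpose ((P ** M) ** (Q ** M))"
    using Q(1) P(4) by (simp flip: matrix_mul_assoc)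
  also have "\<dots> = (Q ** M) ** (P ** M)"
    using P(4) Q(4) by (simp add: matrix_transpose_mul[of "P ** M"])
  also have "\<dots> = Q ** M"
    using P(1) by (simp flip: matrix_mul_assoc)
  finally have 2: "P ** M = Q ** M" .
  have "P = (P ** M) ** P"
    using P(2) by simp
  also have "\<dots> = Q ** (M ** P)"
    unfolding 2 by (simp add: matrix_mul_assoc)
  also have "\<dots> = Q"
    unfolding 1 using Q(2) by (simp add: matrix_mul_assoc)
  finally show ?thesis .
qed

lemma pinv_exists:
  fixes M :: "real^'l^'n"
  shows "\<exists>P. M ** P ** M = M \<and> P ** M ** P = P \<and> transpose (M ** P) = M ** P \<and> transpose (P ** M) = P ** M"
proof -
  have "subspace {x. M *v x = 0}"
    by (auto simp: subspace_def matrix_vector_right_distrib matrix_vector_mult_scaleR)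
  then obtain R where R: "transpose R = R" "\<And>x. M *v (R *v x) = 0" "\<And>x. M *v x = 0 \<Longrightarrow> R *v x = x"
    by (rule orthogonal_projection_matrix_exists) auto
  have "subspace (range ((*v) M))"
    by (intro linear_subspace_image) auto
  then obtain S where S: "transpose S = S" "\<And>x. S *v x \<in> range ((*v) M)" "\<And>x. S *v (M *v x) = M *v x"
    by (rule orthogonal_projection_matrix_exists) auto
  obtain g where g: "linear g" "\<And>y. y \<in> range ((*v) M) \<Longrightarrow> M *v (g y) = y"
    using linear_exists_right_inverse_on[of "(*v) M" UNIV] by auto
  define G where "G = matrix g"
  have G: "M *v (G *v (M *v x)) = M *v x" for x
    using g by (simp add: G_def matrix_works)
  \<comment> \<open>Project onto the range, take any preimage, then remove its component in the
    kernel: \<open>S\<close> and \<open>R\<close> are the orthogonal projectors onto range and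
    kernel.\<close>
  define P where "P = (mat 1 - R) ** G ** S"
  have P: "P *v x = G *v (S *v x) - R *v (G *v (S *v x))" for x
    by (simp add: P_def matrix_vector_mult_diff_rdistrib flip: matrix_vector_mul_assoc)
  have MP: "M *v (P *v x) = S *v x" for x
    using S(2)[of x] by (auto simp: P matrix_vector_mult_diff_distrib R G)
  have PM: "P *v (M *v x) = x - R *v x" for x
  proof -
    have "M *v (G *v (M *v x) - x) = 0"
      by (simp add: matrix_vector_mult_diff_distrib G)
    then have "R *v (G *v (M *v x) - x) = G *v (M *v x) - x"
      by (rule R(3))
    then show ?thesis
      by (simp add: P S(3) matrix_vector_mult_diff_distrib algebra_simps)
  qed
  have MP': "M ** P = S" and PM': "P ** M = mat 1 - R"
    by (simp_all add: matrix_eq MP PM matrix_vector_mult_diff_rdistrib flip: matrix_vector_mul_assoc)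
  have "P *v (S *v x) = P *v x" for x
    using S(2)[of x] by (auto simp: P S(3))
  then have "P ** M ** P = P"
    by (simp add: matrix_eq MP flip: matrix_vector_mul_assoc)
  moreover have "M ** P ** M = M"
    by (simp add: MP' matrix_eq S(3) flip: matrix_vector_mul_assoc)
  moreover have "transpose (mat 1 - R) = mat 1 - R"
    using R(1) by (simp add: transpose_def vec_eq_iff mat_def)
  ultimately show ?thesis
    unfolding MP' PM' using S(1) by (intro exI[of _ P]) (simp add: MP' PM')
qed

lemma pinv_mult: "M ** pinv M ** M = M"
proof -
  obtain P where P: "M ** P ** M = M \<and> P ** M ** P = P \<and> transpose (M ** P) = M ** P \<and> transpose (P ** M) = P ** M"
    using pinv_exists by blast
  moreover have "pinv M = P"
    unfolding pinv_def
  proof (rule the_equality)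
    show "R = P" if "M ** R ** M = M \<and> R ** M ** R = R \<and> transpose (M ** R) = M ** R \<and> transpose (R ** M) = R ** M" for R
      by (rule pinv_unique[of M]) (use that P in blast)+
  qed (rule P)
  ultimately show ?thesis by simp
qed

subsection \<open>Minimum volume\<close>

lemma maps_minus_iff: "M \<in> maps_minus ul un \<longleftrightarrow> (\<forall>x. un \<bullet> (M *v x) = ul \<bullet> x)"
proof -
  have "un \<bullet> (M *v x) = (transpose M *v un) \<bullet> x" for x
    using dot_lmul_matrix[of un M x] by simp
  then show ?thesis
    unfolding maps_minus_def mem_Collect_eq by (simp only: vector_eq_rdot)
qed

text \<open>The image of the ball under a surjective map is also its image under a square matrix, because
  only the orthogonal complement of the kernel matters.\<close>

lemma surjective_image_spherical_space:
  fixes K :: "real^'l^'m" and ul :: "real^'l" and um :: "real^'m"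
  assumes ul: "ul \<noteq> 0" and um: "um \<noteq> 0" and surj: "surj ((*v) K)" and K: "\<And>x. um \<bullet> (K *v x) = ul \<bullet> x"
  obtains H :: "real^'m^'m" where "det H \<noteq> 0" "\<And>x. um \<bullet> (H *v x) = um \<bullet> x"
    "(*v) K ` spherical_space ul = (*v) H ` spherical_space um"
proof -
  \<comment> \<open>The orthogonal complement of the kernel of \<open>K\<close>. It has dimension m
    because \<open>K\<close> is surjective, and contains \<open>ul\<close> because \<open>K\<close>
    pulls the functional of \<open>um\<close> back to that of \<open>ul\<close>.\<close>
  define V where "V = range ((*v) (transpose K))"
  have KT: "x \<bullet> (transpose K *v y) = (K *v x) \<bullet> y" for x y
    using dot_lmul_matrix[of y K x] by (simp add: inner_commute)
  have injT: "inj ((*v) (transpose K))"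
  proof (rule linear_injective_0[THEN iffD2], simp, intro allI impI)
    fix y assume 0: "transpose K *v y = 0"
    obtain x where "K *v x = y"
      using surj by (metis surjD)
    then have "y \<bullet> y = 0"
      using KT[of x y] 0 by (simp only: inner_zero_right)
    then show "y = 0" by simp
  qed
  have "subspace V"
    unfolding V_def by (intro linear_subspace_image) auto
  have "dim V = dim (UNIV :: (real^'m) set)"
    unfolding V_def using injT by (intro dim_image_eq) auto
  from isometry_subspaces[OF subspace_UNIV \<open>subspace V\<close> this[symmetric]]
  obtain f0 where f0: "linear f0" "range f0 = V" "\<And>x :: real^'m. norm (f0 x) = norm x"
    by auto
  have "ul = transpose K *v um"
  proof (rule vector_eq_ldot[THEN iffD1], rule allI)
    show "x \<bullet> ul = x \<bullet> (transpose K *v um)" for x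
      unfolding KT using K[of x] by (simp add: inner_commute)
  qed
  then have "ul \<in> V"
    by (simp add: V_def del: transpose_matrix_vector)
  then obtain a where a: "f0 a = ul"
    using f0(2) by auto
  \<comment> \<open>The ratio of the radii of the two balls. The rotation \<open>T\<close> then
    arranges J um = s ul, so that s times the isometry \<open>J\<close> respects both the
    functionals and the norm bounds.\<close>
  define s where "s = norm um / norm ul"
  have s: "s > 0" "s \<noteq> 0"
    using ul um by (auto simp: s_def)
  have "norm (um /\<^sub>R s) = norm a"
    using f0(3)[of a] a um by (simp add: s_def)
  then obtain T where T: "orthogonal_transformation T" "T (um /\<^sub>R s) = a"
    using orthogonal_transformation_exists by blast
  define J where "J = f0 \<circ> T"
  have J: "linear J" "\<And>x. norm (J x) = norm x" "range J = V" "J um = s *\<^sub>R ul"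
  proof -
    have lT: "linear T" "surj T"
      using T by (auto simp: orthogonal_transformation_linear orthogonal_transformation_surj)
    show lJ: "linear J"
      unfolding J_def by (rule linear_compose[OF lT(1) f0(1)])
    show "norm (J x) = norm x" for x
      using f0(3) T(1) by (simp add: J_def orthogonal_transformation_norm)
    show "range J = V"
      using f0(2) lT(2) by (simp only: J_def image_comp[symmetric])
    have "J (um /\<^sub>R s) = ul"
      by (simp add: J_def T(2) a)
    then show "J um = s *\<^sub>R ul"
      using s linear_scale[OF lJ, of "inverse s" um] by auto
  qed
  have Jip: "J x \<bullet> J y = x \<bullet> y" for x y
    using J(1,2) by (metis orthogonal_transformation_def orthogonal_transformation)
  define H where "H = s *\<^sub>R (K ** matrix J)"
  have H: "H *v x = K *v (s *\<^sub>R J x)" for x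
    using J(1) by (simp add: H_def matrix_works scaleR_matrix_vector_assoc[symmetric] matrix_vector_mult_scaleR
        flip: matrix_vector_mul_assoc)
  have umH: "um \<bullet> (H *v x) = um \<bullet> x" for x
    using Jip[of um x] J(4) by (simp add: H K)
  have perp: "x = 0" if xV: "x \<in> V" "K *v x = 0" for x
  proof -
    obtain y where "x = transpose K *v y"
      using xV(1) unfolding V_def by blast
    then have "x \<bullet> x = 0"
      using KT[of x y] xV(2) by (simp only: inner_zero_left)
    then show ?thesis by simp
  qed
  have "inj ((*v) H)"
  proof (rule linear_injective_0[THEN iffD2], simp, intro allI impI)
    fix x assume "H *v x = 0"
    then have "K *v (J x) = 0"
      using s by (simp add: H matrix_vector_mult_scaleR)
    then have "J x = 0"
      using J(3) by (intro perp) auto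
    then show "x = 0"
      using J(2)[of x] by simp
  qed
  then have "det H \<noteq> 0"
    using det_nz_iff_inj[of "(*v) H"] by simp
  moreover have "(*v) K ` spherical_space ul = (*v) H ` spherical_space um"
  proof (intro equalityI image_subsetI)
    fix x assume "x \<in> spherical_space um"
    then have x: "um \<bullet> x = 1" "(norm x)\<^sup>2 \<le> 2 / (um \<bullet> um)"
      using um by (auto simp: mem_spherical_space)
    have "ul \<bullet> (s *\<^sub>R J x) = 1"
      using umH[of x] x by (simp add: H K)
    moreover have "(norm (s *\<^sub>R J x))\<^sup>2 \<le> 2 / (ul \<bullet> ul)"
    proof -
      have "(norm (s *\<^sub>R J x))\<^sup>2 = s\<^sup>2 * (norm x)\<^sup>2"
        by (simp add: J(2) power_mult_distrib)
      also have "\<dots> \<le> s\<^sup>2 * (2 / (um \<bullet> um))"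
        using x(2) by (rule mult_left_mono) simp
      also have "\<dots> = 2 / (ul \<bullet> ul)"
        using um by (simp add: s_def power_divide power2_norm_eq_inner)
      finally show ?thesis .
    qed
    ultimately have "s *\<^sub>R J x \<in> spherical_space ul"
      using ul by (simp add: mem_spherical_space)
    then show "H *v x \<in> (*v) K ` spherical_space ul"
      unfolding H by (rule imageI)
  next
    fix y assume "y \<in> spherical_space ul"
    then have y: "ul \<bullet> y = 1" "(norm y)\<^sup>2 \<le> 2 / (ul \<bullet> ul)"
      using ul by (auto simp: mem_spherical_space)
    \<comment> \<open>Discarding the component in the kernel changes neither the image under
      \<open>K\<close> nor the functional, and can only shorten the vector, so \<open>y1\<close>
      stays in the ball.\<close>
    obtain y1 y2 where dec: "y1 \<in> span V" "\<And>w. w \<in> span V \<Longrightarrow> orthogonal y2 w" "y = y1 + y2"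
      using orthogonal_subspace_decomp_exists[of V y] by metis
    have y1V: "y1 \<in> V"
      using dec(1) span_minimal[OF subset_refl \<open>subspace V\<close>] by blast
    have "(K *v y2) \<bullet> z = 0" for z
      using dec(2)[of "transpose K *v z"] KT[of y2 z] unfolding orthogonal_def
      by (metis V_def rangeI span_base)
    then have "K *v y2 = 0"
      by (metis inner_eq_zero_iff)
    then have Ky: "K *v y = K *v y1"
      by (simp add: dec(3) matrix_vector_right_distrib)
    have "(norm y)\<^sup>2 = (norm y1)\<^sup>2 + (norm y2)\<^sup>2"
      using dec(2)[OF dec(1)] norm_add_Pythagorean[of y1 y2] by (simp add: dec(3) orthogonal_commute)
    then have ny: "(norm y1)\<^sup>2 \<le> 2 / (ul \<bullet> ul)"
      using y(2) zero_le_power2[of "norm y2"] by linarith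
    obtain x' where x': "y1 = J x'"
      using y1V J(3) by blast
    define x where "x = x' /\<^sub>R s"
    have sJ: "s *\<^sub>R J x = y1"
      using s J(1) by (simp add: x_def x' linear_scale)
    have "um \<bullet> x = 1"
      using umH[of x] K[of y1] K[of y] Ky y(1) by (simp add: H sJ)
    moreover have "(norm x)\<^sup>2 \<le> 2 / (um \<bullet> um)"
    proof -
      have "(norm x)\<^sup>2 = (norm y1)\<^sup>2 / s\<^sup>2"
        using s by (simp add: x_def x' J(2) power_mult_distrib power_inverse divide_inverse mult.commute)
      also have "\<dots> \<le> (2 / (ul \<bullet> ul)) / s\<^sup>2"
        using ny by (rule divide_right_mono) simp
      also have "\<dots> = 2 / (um \<bullet> um)"
        using ul by (simp add: s_def power_divide power2_norm_eq_inner)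
      finally show ?thesis .
    qed
    ultimately have "x \<in> spherical_space um"
      using um by (simp add: mem_spherical_space)
    moreover have "K *v y = H *v x"
      by (simp add: H sJ Ky)
    ultimately show "K *v y \<in> (*v) H ` spherical_space um"
      by blast
  qed
  ultimately show thesis
    using umH by (intro that)
qed

lemma symmetry_group_image_spherical_space:
  assumes u: "u \<noteq> 0" and g: "g \<in> symmetry_group u"
  shows "(*v) g ` spherical_space u = spherical_space u"
proof -
  have sub: "(*v) h ` spherical_space u \<subseteq> spherical_space u" if h: "h \<in> symmetry_group u" for h
  proof -
    have "orthogonal_transformation ((*v) h)"
      using h by (simp add: symmetry_group_def orthogonal_transformation_matrix)
    then have "norm (h *v x) = norm x" "(h *v x) \<bullet> (h *v y) = x \<bullet> y" for x y
      by (auto simp: orthogonal_transformation_norm) (simp add: orthogonal_transformation_def)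
    moreover have "h *v u = u"
      using h by (simp add: symmetry_group_def)
    ultimately have "u \<bullet> (h *v x) = u \<bullet> x" "norm (h *v x) = norm x" for x
      by metis+
    then show ?thesis
      using u by (auto simp: mem_spherical_space)
  qed
  have "x \<in> (*v) g ` spherical_space u" if "x \<in> spherical_space u" for x
  proof -
    have "x = g *v (transpose g *v x)"
      using symmetry_group_inverse(2)[OF g] by (simp add: matrix_vector_mul_assoc del: transpose_matrix_vector)
    moreover have "transpose g *v x \<in> spherical_space u"
      using sub[OF symmetry_group_transpose[OF g]] that by blast
    ultimately show ?thesis by blast
  qed
  then show ?thesis
    using sub[OF g] by blast
qed

theorem theorem4:
  fixes ul :: "real^'l" and um :: "real^'m" and un :: "real^'n"
    and X :: "(real^'l) set" and L :: "real^'l^'m" and M :: "real^'l^'n"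
  assumes "ul \<noteq> 0" and "um \<noteq> 0" and "un \<noteq> 0"
    and "X \<subseteq> spherical_space ul"
    and "L \<in> maps_minus ul um"
    and "(*v) L ` spherical_space ul = spherical_space um"
    and "supports_spherical_design um 2 ((*v) L ` X)"
    and "M \<in> maps_minus ul un"
    and "dim (supp M) = CARD('m)"
    and "pinv M ** M = pinv L ** L"
  shows "observationally_complete ul un X (spherical_space ul) M"
proof -
  note ul = assms(1) and um = assms(2)
  let ?Xl = "spherical_space ul" and ?Xm = "spherical_space um"
  define S where "S = (*v) L ` X"
  have SX: "S \<subseteq> ?Xm"
    using assms(4,6) by (auto simp: S_def)
  have L: "um \<bullet> (L *v x) = ul \<bullet> x" and M: "un \<bullet> (M *v x) = ul \<bullet> x" for x
    using assms(5,8) by (auto simp: maps_minus_iff)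
  obtain N p v where v: "\<And>k. k < N \<Longrightarrow> v k \<in> S" and
    design: "spherical_design um 2 N p (\<lambda>k. inverse (um \<bullet> v k) *\<^sub>R v k)"
    using assms(7) unfolding supports_spherical_design_def S_def by blast
  \<comment> \<open>Points of \<open>S\<close> already satisfy \<open>um \<bullet> v = 1\<close>, so
    this rescaling is the identity and the design lies in \<open>S\<close>.\<close>
  define v' where "v' k = inverse (um \<bullet> v k) *\<^sub>R v k" for k
  have v'S: "v' k \<in> S" if "k < N" for k
    using v[OF that] SX by (auto simp: v'_def spherical_space_def)
  obtain \<beta> where \<beta>: "0 < \<beta>" "CARD('m) = 1 \<or> \<beta> * (real CARD('m) - 1) = 1 / (um \<bullet> um)"
    "\<And>x. (\<Sum>k<N. p k * (x \<bullet> v' k)\<^sup>2) = ((x \<bullet> um) / (um \<bullet> um))\<^sup>2 + \<beta> * (x \<bullet> x - (x \<bullet> um)\<^sup>2 / (um \<bullet> um))"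
    using spherical_2_design_second_moment[OF um design] unfolding v'_def by blast
  have p: "\<And>k. k < N \<Longrightarrow> 0 \<le> p k" "(\<Sum>k<N. p k) = 1"
    using design by (auto simp: spherical_design_def)

  \<comment> \<open>The second moment is positive definite because \<beta> > 0, by Cauchy-Schwarz; a
    vector orthogonal to \<open>S\<close> would make it vanish.\<close>
  have spanS: "span S = UNIV"
  proof (rule ccontr)
    assume "span S \<noteq> UNIV"
    then obtain x where x: "x \<noteq> 0" "\<And>y. y \<in> span S \<Longrightarrow> orthogonal x y"
      using orthogonal_to_subspace_exists_gen[of S UNIV] by (auto simp: psubset_eq)
    then have "(\<Sum>k<N. p k * (x \<bullet> v' k)\<^sup>2) = 0"
      using v'S by (intro sum.neutral) (auto simp: orthogonal_def span_base)
    then have sum0: "((x \<bullet> um) / (um \<bullet> um))\<^sup>2 + \<beta> * (x \<bullet> x - (x \<bullet> um)\<^sup>2 / (um \<bullet> um)) = 0"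
      by (simp add: \<beta>(3))
    have "(x \<bullet> um)\<^sup>2 \<le> (x \<bullet> x) * (um \<bullet> um)"
      by (rule Cauchy_Schwarz_ineq)
    then have "0 \<le> x \<bullet> x - (x \<bullet> um)\<^sup>2 / (um \<bullet> um)"
      using um by (simp add: divide_le_eq)
    then have nn: "0 \<le> \<beta> * (x \<bullet> x - (x \<bullet> um)\<^sup>2 / (um \<bullet> um))"
      using \<beta>(1) by simp
    have "((x \<bullet> um) / (um \<bullet> um))\<^sup>2 = 0"
      using sum0 nn zero_le_power2[of "(x \<bullet> um) / (um \<bullet> um)"] by linarith
    then have "x \<bullet> um = 0"
      using um by simp
    then have "\<beta> * (x \<bullet> x) = 0"
      using sum0 by simp
    then show False
      using x(1) \<beta>(1) by simp
  qed

  define P where "P = M ** pinv L"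
  have MPL: "M = P ** L"
    using pinv_mult[of M] assms(10) by (simp add: P_def flip: matrix_mul_assoc)
  \<comment> \<open>Equality of the two projectors puts the kernel of \<open>M\<close> inside that
    of \<open>L\<close>, which makes the factor \<open>P\<close> injective.\<close>
  have kerL: "L *v x = 0" if "M *v x = 0" for x
  proof -
    have "L *v x = (L ** (pinv L ** L)) *v x"
      using pinv_mult[of L] by (simp add: matrix_mul_assoc)
    also have "\<dots> = L *v (pinv M *v (M *v x))"
      by (simp add: matrix_vector_mul_assoc flip: assms(10) matrix_mul_assoc)
    finally show ?thesis
      using that by simp
  qed
  have "range ((*v) L) = UNIV"
  proof -
    have "?Xm \<subseteq> range ((*v) L)"
      using assms(6) by blast
    then have "span ?Xm \<subseteq> range ((*v) L)"
      by (intro span_minimal linear_subspace_image) auto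
    then show ?thesis
      using span_spherical_space[OF um] by auto
  qed
  then have surjL: "\<exists>x. y = L *v x" for y
    by (metis UNIV_I imageE)
  have injP: "inj ((*v) P)"
  proof (rule linear_injective_0[THEN iffD2], simp, intro allI impI)
    fix y assume 0: "P *v y = 0"
    obtain x where "y = L *v x" using surjL by blast
    then show "y = 0"
      using 0 kerL[of x] by (simp add: MPL matrix_vector_mul_assoc)
  qed
  then obtain Q where Q: "Q ** P = mat 1"
    using matrix_left_invertible_injective[of P] by auto
  have QP: "Q *v (P *v x) = x" for x
    by (simp add: matrix_vector_mul_assoc Q)
  have Pu: "un \<bullet> (P *v y) = um \<bullet> y" for y
  proof -
    obtain x where "y = L *v x" using surjL by blast
    then show ?thesis
      using M[of x] L[of x] by (simp add: MPL flip: matrix_vector_mul_assoc)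
  qed
  have MXl: "(*v) M ` ?Xl = (*v) P ` ?Xm"
    unfolding assms(6)[symmetric] by (simp add: MPL image_image matrix_vector_mul_assoc)
  have MX: "(*v) M ` X = (*v) P ` S"
    by (simp add: S_def MPL image_image matrix_vector_mul_assoc)
  have spanMX: "span ((*v) M ` X) = range ((*v) P)"
    unfolding MX by (subst span_linear_image) (auto simp: spanS)

  \<comment> \<open>The span condition confines the image of \<open>K\<close> to the range of
    \<open>P\<close>, so \<open>K\<close> factors as \<open>P\<close> after some \<open>K'\<close>.
    The image of the ball under \<open>K'\<close> contains the spanning set \<open>S\<close>, so
    \<open>K'\<close> is surjective and can be replaced by a square matrix \<open>H\<close>.\<close>
  have candidate: "\<exists>H. det H \<noteq> 0 \<and> (\<forall>x. um \<bullet> (H *v x) = um \<bullet> x) \<and> 1 \<le> \<bar>det H\<bar> \<and>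
      (\<bar>det H\<bar> = 1 \<longrightarrow> (*v) H ` ?Xm = ?Xm) \<and> (*v) K ` ?Xl = (*v) P ` (*v) H ` ?Xm"
    if "K \<in> ddi_candidates ul un ((*v) M ` X) ?Xl" for K
  proof -
    have Ku: "un \<bullet> (K *v x) = ul \<bullet> x" for x
      using that by (auto simp: ddi_candidates_def maps_minus_iff)
    have sup: "(*v) P ` S \<subseteq> (*v) K ` ?Xl" and sub: "(*v) K ` ?Xl \<subseteq> range ((*v) P)"
      using that spanMX by (auto simp: ddi_candidates_def MX)
    have "(*v) K ` span ?Xl \<subseteq> range ((*v) P)"
    proof -
      have "span ((*v) K ` ?Xl) \<subseteq> range ((*v) P)"
        using sub by (intro span_minimal linear_subspace_image) auto
      then show ?thesis
        by (simp add: span_linear_image)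
    qed
    then have "K *v x \<in> range ((*v) P)" for x
      by (auto simp: span_spherical_space[OF ul])
    define K' where "K' = Q ** K"
    have PK': "P *v (K' *v x) = K *v x" for x
    proof -
      obtain y where "K *v x = P *v y"
        using \<open>\<And>x. K *v x \<in> range ((*v) P)\<close> by blast
      then show ?thesis
        by (simp add: K'_def QP flip: matrix_vector_mul_assoc)
    qed
    have K'u: "um \<bullet> (K' *v x) = ul \<bullet> x" for x
      using Pu[of "K' *v x"] by (simp add: PK' Ku)
    have SK': "S \<subseteq> (*v) K' ` ?Xl"
    proof
      fix s assume "s \<in> S"
      then obtain x where "x \<in> ?Xl" "P *v s = K *v x"
        using sup by blast
      then have "s = K' *v x"
        using QP[of s] by (simp add: K'_def flip: matrix_vector_mul_assoc)
      then show "s \<in> (*v) K' ` ?Xl"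
        using \<open>x \<in> ?Xl\<close> by blast
    qed
    have "surj ((*v) K')"
    proof -
      have "span S \<subseteq> range ((*v) K')"
        using SK' by (intro span_minimal linear_subspace_image) auto
      then show ?thesis
        using spanS by auto
    qed
    then obtain H :: "real^'m^'m" where H: "det H \<noteq> 0" "\<And>x. um \<bullet> (H *v x) = um \<bullet> x" "(*v) K' ` ?Xl = (*v) H ` ?Xm"
      using surjective_image_spherical_space[OF ul um _ K'u] by blast
    obtain G where G: "H ** G = mat 1" "G ** H = mat 1"
      using H(1) invertible_det_nz[of H] unfolding invertible_def by blast
    have HG: "H *v (G *v x) = x" and GH: "G *v (H *v x) = x" for x
      by (simp_all add: matrix_vector_mul_assoc G)
    have dets: "\<bar>det H\<bar> * \<bar>det G\<bar> = 1"
      using arg_cong[OF G(1), of det] by (simp add: det_mul flip: abs_mult)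
    have Gu: "um \<bullet> (G *v x) = um \<bullet> x" for x
      using H(2)[of "G *v x"] by (simp add: HG)
    \<comment> \<open>Containment of the design in the ellipsoid, read through the inverse:
      \<open>G\<close> sends each design point into the ball.\<close>
    have Gv: "(norm (G *v v' k))\<^sup>2 \<le> 2 / (um \<bullet> um)" if k: "k < N" for k
    proof -
      obtain x where "x \<in> ?Xm" "v' k = H *v x"
        using v'S[OF k] SK' H(3) by blast
      then show ?thesis
        using um by (simp add: GH mem_spherical_space)
    qed
    note john = john_inequality[OF um Gu \<beta>(1,2) p \<beta>(3) Gv]
    have "0 < \<bar>det G\<bar>"
      using dets by auto
    then have "1 \<le> \<bar>det H\<bar>"
      using john(1) dets mult_left_mono[OF john(1), of "\<bar>det H\<bar>"] by simp
    moreover have "(*v) H ` ?Xm = ?Xm" if "\<bar>det H\<bar> = 1"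
    proof -
      have "G \<in> symmetry_group um"
        using john(2) dets that by simp
      then have "(*v) G ` ?Xm = ?Xm"
        by (rule symmetry_group_image_spherical_space[OF um])
      then have "(*v) H ` ?Xm = (*v) H ` (*v) G ` ?Xm"
        by simp
      then show ?thesis
        by (simp add: image_image HG)
    qed
    moreover have "(*v) K ` ?Xl = (*v) P ` (*v) H ` ?Xm"
      unfolding H(3)[symmetric] by (simp add: image_image PK')
    ultimately show ?thesis
      using H(1,2) by blast
  qed
  note vol = vol_linear_image_spherical_space[OF um Q]
  have vol0: "vol ((*v) P ` ?Xm) \<noteq> 0" "vol ((*v) P ` ?Xm) \<noteq> \<infinity>"
    using vol(2,3)[of "mat 1"] by simp_all
  have volK: "vol ((*v) M ` ?Xl) \<le> vol ((*v) K ` ?Xl) \<and>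
      (vol ((*v) K ` ?Xl) \<le> vol ((*v) M ` ?Xl) \<longrightarrow> (*v) K ` ?Xl = (*v) M ` ?Xl)"
    if K: "K \<in> ddi_candidates ul un ((*v) M ` X) ?Xl" for K
  proof -
    obtain H where H: "det H \<noteq> 0" "\<And>x. um \<bullet> (H *v x) = um \<bullet> x" "1 \<le> \<bar>det H\<bar>"
      "\<bar>det H\<bar> = 1 \<Longrightarrow> (*v) H ` ?Xm = ?Xm" "(*v) K ` ?Xl = (*v) P ` (*v) H ` ?Xm"
      using candidate[OF K] by blast
    let ?V = "vol ((*v) P ` ?Xm)"
    have eq: "vol ((*v) K ` ?Xl) = ennreal \<bar>det H\<bar> * ?V"
      unfolding H(5) by (rule vol(1)[OF H(1,2)])
    \<comment> \<open>A finite positive volume can be cancelled: a competitor no larger than the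
      image of \<open>M\<close> has |det H| = 1, and the equality case identifies the two
      images.\<close>
    obtain r where r: "?V = ennreal r" "0 < r"
      using vol0 by (cases ?V) (auto simp: less_le)
    have "?V \<le> ennreal \<bar>det H\<bar> * ?V"
      using H(3) r by (simp add: ennreal_mult'[symmetric])
    moreover have "(*v) K ` ?Xl = (*v) M ` ?Xl" if "ennreal \<bar>det H\<bar> * ?V \<le> ?V"
    proof -
      have "\<bar>det H\<bar> * r \<le> r"
        using that r by (simp add: ennreal_mult'[symmetric])
      then have "\<bar>det H\<bar> = 1"
        using H(3) r(2) by simp
      then show ?thesis
        using H(4,5) MXl by simp
    qed
    ultimately show ?thesis
      unfolding MXl[symmetric] eq[unfolded MXl[symmetric]] by blast
  qed
  have Mc: "M \<in> ddi_candidates ul un ((*v) M ` X) ?Xl"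
  proof -
    have "(*v) M ` ?Xl \<subseteq> span ((*v) M ` X)"
      unfolding spanMX MXl by blast
    then show ?thesis
      using assms(4,8) by (auto simp: ddi_candidates_def)
  qed
  have "ddi ul un ((*v) M ` X) ?Xl = {(*v) M ` ?Xl}"
  proof (intro equalityI subsetI)
    fix Z assume "Z \<in> ddi ul un ((*v) M ` X) ?Xl"
    then obtain K where K: "Z = (*v) K ` ?Xl"
      "is_arg_min (\<lambda>K. vol ((*v) K ` ?Xl)) (\<lambda>K. K \<in> ddi_candidates ul un ((*v) M ` X) ?Xl) K"
      by (auto simp: ddi_def)
    then have "vol ((*v) K ` ?Xl) \<le> vol ((*v) M ` ?Xl)"
      using Mc by (auto simp: is_arg_min_def not_less)
    then show "Z \<in> {(*v) M ` ?Xl}"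
      using K volK by (auto simp: is_arg_min_def)
  next
    fix Z assume "Z \<in> {(*v) M ` ?Xl}"
    moreover have "is_arg_min (\<lambda>K. vol ((*v) K ` ?Xl)) (\<lambda>K. K \<in> ddi_candidates ul un ((*v) M ` X) ?Xl) M"
      using Mc volK unfolding is_arg_min_def by (simp add: not_less)
    ultimately show "Z \<in> ddi ul un ((*v) M ` X) ?Xl"
      by (auto simp: ddi_def)
  qed
  then show ?thesis
    by (simp add: observationally_complete_def)
qed

end
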